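(* Let $C,B$ be dually paired Hopf algebras in a braided monoidal category $\mathcal{B}$. Then the monoidal category ${}^{C}\mathcal{YD}^{B}(\mathcal{B})$ acts on the category ${}^{C}\mathcal{H}^{B}(\mathcal{B})$, where $V\triangleright W:=V\otimes W$ with left $C$-action on $V\otimes W$ given by $\Delta_C$ and right $B$-action on $V\otimes W$ given by $\Delta_B$.
   Context: $\mathcal{B}$ is treated as strict monoidal, with unit $I$ and braiding $\Psi$. Hopf algebras in $\mathcal{B}$ satisfy $\Delta m=(m\otimes m)(\mathrm{id}\otimes\Psi\otimes\mathrm{id})(\Delta\otimes\Delta)$. Dually paired Hopf algebras: Hopf algebras $C,B$ in $\mathcal{B}$ with invertible antipodes and a morphism $\mathrm{ev}\colon C\otimes B\to I$ such that $\mathrm{ev}(m_C\otimes\mathrm{id}_B)=\mathrm{ev}(\mathrm{id}_C\otimes\mathrm{ev}\otimes\mathrm{id}_B)(\mathrm{id}_{C\otimes C}\otimes\Delta_B)$, $\mathrm{ev}(\mathrm{id}_C\otimes m_B)=\mathrm{ev}(\mathrm{id}_C\otimes\mathrm{ev}\otimes\mathrm{id}_B)(\Delta_C\otimes\mathrm{id}_{B\otimes B})$, $\mathrm{ev}(1_C\otimes\mathrm{id}_B)=\varepsilon_B$, $\mathrm{ev}(\mathrm{id}_C\otimes 1_B)=\varepsilon_C$, $\mathrm{ev}(S\otimes\mathrm{id})=\mathrm{ev}(\mathrm{id}\otimes S)$. ${}^{C}\mathcal{YD}^{B}(\mathcal{B})$: objects $V$ of $\mathcal{B}$ with a left $C$-action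 $\triangleright$ and a right $B$-action $\triangleleft$ in $\mathcal{B}$ satisfying, as morphisms $C\otimes V\otimes B\to V$, $$(\mathrm{ev}\otimes \triangleleft)(\mathrm{id}_C\otimes \Psi_{V,B}\otimes \mathrm{id}_B)(\mathrm{id}_C\otimes \triangleright \otimes \mathrm{id}_{B\otimes B})(\Delta_C\otimes \mathrm{id}_V\otimes \Delta_B)=(\triangleright \otimes \mathrm{ev})(\mathrm{id}_C\otimes \Psi_{C,V}\otimes \mathrm{id}_B)(\mathrm{id}_{C\otimes C}\otimes \triangleleft \otimes \mathrm{id}_B)(\Delta_C\otimes \mathrm{id}_V\otimes \Delta_B).$$ ${}^{C}\mathcal{H}^{B}(\mathcal{B})$: objects $V$ of $\mathcal{B}$ with a left $C$-action and a right $B$-action satisfying $$\triangleright(\mathrm{id}_{C}\otimes \triangleleft)=(\mathrm{ev}\otimes \triangleleft)(\mathrm{id}_C\otimes \Psi_{V,B}\otimes \mathrm{id}_B)(\mathrm{id}_C\otimes \triangleright \otimes \mathrm{id}_{B\otimes B})(\Delta_C\otimes \mathrm{id}_V \otimes \Delta_B).$$ In both cases morphisms commute with both actions. Tensor product actions: the left $C$-action on $V\otimes W$ is $(\triangleright_V\otimes\triangleright_W)(\mathrm{id}_C\otimes\Psi_{C,V}\otimes\mathrm{id}_W)(\Delta_C\otimes\mathrm{id}_{V\otimes W})$ and the right $B$-action is $(\triangleleft_V\otimes\triangleleft_W)(\mathrm{id}_V\otimes\Psi_{W,B}\otimes\mathrm{id}_B)(\mathrm{id}_{V\otimes W}\otimes\Delta_B)$;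 these give the monoidal structure of ${}^{C}\mathcal{YD}^{B}(\mathcal{B})$. "Acts" means that $\triangleright$ defines a left module category structure. *)

theory Defs
  imports Main
begin

section \<open>Categories\<close>

record ('o, 'a) category =
  Obj :: "'o set"
  Arr :: "'a set"
  Dom :: "'a \<Rightarrow> 'o"
  Cod :: "'a \<Rightarrow> 'o"
  Ident :: "'o \<Rightarrow> 'a"  ("\<iota>\<index>")
  Comp :: "'a \<Rightarrow> 'a \<Rightarrow> 'a"  (infixr "\<cdot>\<index>" 55)

text \<open>Composition is written in applicative order: \<open>g \<cdot> f\<close> is \<open>f\<close> followed by \<open>g\<close>.\<close>

definition hom :: "('o, 'a, 'm) category_scheme \<Rightarrow> 'o \<Rightarrow> 'o \<Rightarrow> 'a set" where
  "hom M X Y = {f \<in> Arr M. Dom M f = X \<and> Cod M f = Y}"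

locale category =
  fixes M :: "('o, 'a, 'm) category_scheme" (structure)
  assumes Dom_Obj: "f \<in> Arr M \<Longrightarrow> Dom M f \<in> Obj M"
    and Cod_Obj: "f \<in> Arr M \<Longrightarrow> Cod M f \<in> Obj M"
    and Ident_hom: "X \<in> Obj M \<Longrightarrow> \<iota> X \<in> hom M X X"
    and Comp_hom: "f \<in> hom M X Y \<Longrightarrow> g \<in> hom M Y Z \<Longrightarrow> g \<cdot> f \<in> hom M X Z"
    and Comp_Ident: "f \<in> hom M X Y \<Longrightarrow> f \<cdot> \<iota> X = f"
    and Ident_Comp: "f \<in> hom M X Y \<Longrightarrow> \<iota> Y \<cdot> f = f"
    and Comp_assoc: "f \<in> hom M W X \<Longrightarrow> g \<in> hom M X Y \<Longrightarrow> h \<in> hom M Y Z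
      \<Longrightarrow> (h \<cdot> g) \<cdot> f = h \<cdot> (g \<cdot> f)"

definition iso :: "('o, 'a, 'm) category_scheme \<Rightarrow> 'a \<Rightarrow> bool" where
  "iso M f \<longleftrightarrow> f \<in> Arr M \<and>
    (\<exists>g \<in> hom M (Cod M f) (Dom M f).
      Comp M g f = Ident M (Dom M f) \<and> Comp M f g = Ident M (Cod M f))"


section \<open>Strict monoidal and braided categories\<close>

record ('o, 'a) monoidal_category = "('o, 'a) category" +
  Unit :: "'o"  ("\<I>\<index>")
  TensorO :: "'o \<Rightarrow> 'o \<Rightarrow> 'o"  (infixr "\<odot>\<index>" 72)
  TensorA :: "'a \<Rightarrow> 'a \<Rightarrow> 'a"  (infixr "\<otimes>\<index>" 70)

text \<open>The tensor product is \<open>\<odot>\<close> on objects and \<open>\<otimes>\<close> on arrows.\<close>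

locale strict_monoidal_category = category M
  for M :: "('o, 'a, 'm) monoidal_category_scheme" (structure) +
  assumes Unit_Obj: "\<I> \<in> Obj M"
    and TensorO_Obj: "X \<in> Obj M \<Longrightarrow> Y \<in> Obj M \<Longrightarrow> X \<odot> Y \<in> Obj M"
    and TensorA_hom: "f \<in> hom M X X' \<Longrightarrow> g \<in> hom M Y Y'
      \<Longrightarrow> f \<otimes> g \<in> hom M (X \<odot> Y) (X' \<odot> Y')"
    and TensorA_Ident: "X \<in> Obj M \<Longrightarrow> Y \<in> Obj M \<Longrightarrow> \<iota> X \<otimes> \<iota> Y = \<iota> (X \<odot> Y)"
    and TensorA_Comp: "f \<in> hom M X X' \<Longrightarrow> f' \<in> hom M X' X''
      \<Longrightarrow> g \<in> hom M Y Y' \<Longrightarrow> g' \<in> hom M Y' Y''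
      \<Longrightarrow> (f' \<cdot> f) \<otimes> (g' \<cdot> g) = (f' \<otimes> g') \<cdot> (f \<otimes> g)"
    and TensorO_assoc: "X \<in> Obj M \<Longrightarrow> Y \<in> Obj M \<Longrightarrow> Z \<in> Obj M
      \<Longrightarrow> (X \<odot> Y) \<odot> Z = X \<odot> (Y \<odot> Z)"
    and TensorO_Unit_left: "X \<in> Obj M \<Longrightarrow> \<I> \<odot> X = X"
    and TensorO_Unit_right: "X \<in> Obj M \<Longrightarrow> X \<odot> \<I> = X"
    and TensorA_assoc: "f \<in> Arr M \<Longrightarrow> g \<in> Arr M \<Longrightarrow> h \<in> Arr M
      \<Longrightarrow> (f \<otimes> g) \<otimes> h = f \<otimes> (g \<otimes> h)"
    and TensorA_Unit_left: "f \<in> Arr M \<Longrightarrow> \<iota> \<I> \<otimes> f = f"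
    and TensorA_Unit_right: "f \<in> Arr M \<Longrightarrow> f \<otimes> \<iota> \<I> = f"

record ('o, 'a) braided_category = "('o, 'a) monoidal_category" +
  Braid :: "'o \<Rightarrow> 'o \<Rightarrow> 'a"  ("\<Psi>\<index>")

locale braided_monoidal_category = strict_monoidal_category M
  for M :: "('o, 'a, 'm) braided_category_scheme" (structure) +
  assumes Braid_hom: "X \<in> Obj M \<Longrightarrow> Y \<in> Obj M \<Longrightarrow> \<Psi> X Y \<in> hom M (X \<odot> Y) (Y \<odot> X)"
    and Braid_iso: "X \<in> Obj M \<Longrightarrow> Y \<in> Obj M \<Longrightarrow> iso M (\<Psi> X Y)"
    and Braid_natural: "f \<in> hom M X X' \<Longrightarrow> g \<in> hom M Y Y'
      \<Longrightarrow> \<Psi> X' Y' \<cdot> (f \<otimes> g) = (g \<otimes> f) \<cdot> \<Psi> X Y"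
    and Braid_TensorO_left: "X \<in> Obj M \<Longrightarrow> Y \<in> Obj M \<Longrightarrow> Z \<in> Obj M
      \<Longrightarrow> \<Psi> (X \<odot> Y) Z = (\<Psi> X Z \<otimes> \<iota> Y) \<cdot> (\<iota> X \<otimes> \<Psi> Y Z)"
    and Braid_TensorO_right: "X \<in> Obj M \<Longrightarrow> Y \<in> Obj M \<Longrightarrow> Z \<in> Obj M
      \<Longrightarrow> \<Psi> X (Y \<odot> Z) = (\<iota> Y \<otimes> \<Psi> X Z) \<cdot> (\<Psi> X Y \<otimes> \<iota> Z)"


section \<open>Left module categories\<close>

text \<open>
  \<open>actO\<close> and \<open>actA\<close> are the object and arrow maps of a bifunctor \<open>M \<times> N \<rightarrow> N\<close>,
  \<open>assc X Y Z : (X \<otimes> Y) \<triangleright> Z \<rightarrow> X \<triangleright> (Y \<triangleright> Z)\<close> and \<open>unitor Z : I \<triangleright> Z \<rightarrow> Z\<close>.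
  As \<open>M\<close> is strict, its own associator and unitors do not occur in the coherence axioms.
\<close>

locale left_module_category = M: strict_monoidal_category M + N: category N
  for M :: "('o, 'a, 'm) monoidal_category_scheme"
    and N :: "('p, 'b, 'n) category_scheme" +
  fixes actO :: "'o \<Rightarrow> 'p \<Rightarrow> 'p"
    and actA :: "'a \<Rightarrow> 'b \<Rightarrow> 'b"
    and assc :: "'o \<Rightarrow> 'o \<Rightarrow> 'p \<Rightarrow> 'b"
    and unitor :: "'p \<Rightarrow> 'b"
  assumes actO_Obj: "X \<in> Obj M \<Longrightarrow> Z \<in> Obj N \<Longrightarrow> actO X Z \<in> Obj N"
    and actA_hom: "f \<in> hom M X X' \<Longrightarrow> h \<in> hom N Z Z'
      \<Longrightarrow> actA f h \<in> hom N (actO X Z) (actO X' Z')"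
    and actA_Ident: "X \<in> Obj M \<Longrightarrow> Z \<in> Obj N
      \<Longrightarrow> actA (Ident M X) (Ident N Z) = Ident N (actO X Z)"
    and actA_Comp: "f \<in> hom M X X' \<Longrightarrow> f' \<in> hom M X' X''
      \<Longrightarrow> h \<in> hom N Z Z' \<Longrightarrow> h' \<in> hom N Z' Z''
      \<Longrightarrow> actA (f' \<cdot>\<^bsub>M\<^esub> f) (h' \<cdot>\<^bsub>N\<^esub> h) = actA f' h' \<cdot>\<^bsub>N\<^esub> actA f h"
    and assc_hom: "X \<in> Obj M \<Longrightarrow> Y \<in> Obj M \<Longrightarrow> Z \<in> Obj N
      \<Longrightarrow> assc X Y Z \<in> hom N (actO (X \<odot>\<^bsub>M\<^esub> Y) Z) (actO X (actO Y Z))"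
    and assc_iso: "X \<in> Obj M \<Longrightarrow> Y \<in> Obj M \<Longrightarrow> Z \<in> Obj N \<Longrightarrow> iso N (assc X Y Z)"
    and assc_natural: "f \<in> hom M X X' \<Longrightarrow> g \<in> hom M Y Y' \<Longrightarrow> h \<in> hom N Z Z'
      \<Longrightarrow> assc X' Y' Z' \<cdot>\<^bsub>N\<^esub> actA (f \<otimes>\<^bsub>M\<^esub> g) h = actA f (actA g h) \<cdot>\<^bsub>N\<^esub> assc X Y Z"
    and unitor_hom: "Z \<in> Obj N \<Longrightarrow> unitor Z \<in> hom N (actO (Unit M) Z) Z"
    and unitor_iso: "Z \<in> Obj N \<Longrightarrow> iso N (unitor Z)"
    and unitor_natural: "h \<in> hom N Z Z'
      \<Longrightarrow> unitor Z' \<cdot>\<^bsub>N\<^esub> actA (Ident M (Unit M)) h = h \<cdot>\<^bsub>N\<^esub> unitor Z"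
    and pentagon: "W \<in> Obj M \<Longrightarrow> X \<in> Obj M \<Longrightarrow> Y \<in> Obj M \<Longrightarrow> Z \<in> Obj N
      \<Longrightarrow> actA (Ident M W) (assc X Y Z) \<cdot>\<^bsub>N\<^esub> assc W (X \<odot>\<^bsub>M\<^esub> Y) Z
        = assc W X (actO Y Z) \<cdot>\<^bsub>N\<^esub> assc (W \<odot>\<^bsub>M\<^esub> X) Y Z"
    and triangle: "X \<in> Obj M \<Longrightarrow> Z \<in> Obj N
      \<Longrightarrow> actA (Ident M X) (unitor Z) \<cdot>\<^bsub>N\<^esub> assc X (Unit M) Z
        = actA (Ident M X) (Ident N Z)"


section \<open>Dually paired Hopf algebras\<close>

record ('o, 'a) hopf =
  Ob :: "'o"
  mul :: "'a"
  one :: "'a"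
  comul :: "'a"
  counit :: "'a"
  antipode :: "'a"

locale hopf_algebra = braided_monoidal_category M
  for M :: "('o, 'a, 'm) braided_category_scheme" (structure) +
  fixes H :: "('o, 'a) hopf"
  assumes Ob_Obj: "Ob H \<in> Obj M"
    and mul_hom: "mul H \<in> hom M (Ob H \<odot> Ob H) (Ob H)"
    and one_hom: "one H \<in> hom M \<I> (Ob H)"
    and comul_hom: "comul H \<in> hom M (Ob H) (Ob H \<odot> Ob H)"
    and counit_hom: "counit H \<in> hom M (Ob H) \<I>"
    and antipode_hom: "antipode H \<in> hom M (Ob H) (Ob H)"
    and mul_assoc: "mul H \<cdot> (mul H \<otimes> \<iota> (Ob H)) = mul H \<cdot> (\<iota> (Ob H) \<otimes> mul H)"
    and mul_one_left: "mul H \<cdot> (one H \<otimes> \<iota> (Ob H)) = \<iota> (Ob H)"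
    and mul_one_right: "mul H \<cdot> (\<iota> (Ob H) \<otimes> one H) = \<iota> (Ob H)"
    and comul_coassoc: "(comul H \<otimes> \<iota> (Ob H)) \<cdot> comul H = (\<iota> (Ob H) \<otimes> comul H) \<cdot> comul H"
    and comul_counit_left: "(counit H \<otimes> \<iota> (Ob H)) \<cdot> comul H = \<iota> (Ob H)"
    and comul_counit_right: "(\<iota> (Ob H) \<otimes> counit H) \<cdot> comul H = \<iota> (Ob H)"
    and comul_mul: "comul H \<cdot> mul H
      = (mul H \<otimes> mul H) \<cdot> (\<iota> (Ob H) \<otimes> \<Psi> (Ob H) (Ob H) \<otimes> \<iota> (Ob H)) \<cdot> (comul H \<otimes> comul H)"
    and comul_one: "comul H \<cdot> one H = one H \<otimes> one H"
    and counit_mul: "counit H \<cdot> mul H = counit H \<otimes> counit H"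
    and counit_one: "counit H \<cdot> one H = \<iota> \<I>"
    and antipode_left: "mul H \<cdot> (antipode H \<otimes> \<iota> (Ob H)) \<cdot> comul H = one H \<cdot> counit H"
    and antipode_right: "mul H \<cdot> (\<iota> (Ob H) \<otimes> antipode H) \<cdot> comul H = one H \<cdot> counit H"

locale dually_paired_hopf_algebras = C: hopf_algebra M C + B: hopf_algebra M B
  for M :: "('o, 'a, 'm) braided_category_scheme" (structure)
    and C :: "('o, 'a) hopf"
    and B :: "('o, 'a) hopf" +
  fixes ev :: "'a"
  assumes antipode_C_iso: "iso M (antipode C)"
    and antipode_B_iso: "iso M (antipode B)"
    and ev_hom: "ev \<in> hom M (Ob C \<odot> Ob B) \<I>"
    and ev_mul_left: "ev \<cdot> (mul C \<otimes> \<iota> (Ob B))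
      = ev \<cdot> (\<iota> (Ob C) \<otimes> ev \<otimes> \<iota> (Ob B)) \<cdot> (\<iota> (Ob C \<odot> Ob C) \<otimes> comul B)"
    and ev_mul_right: "ev \<cdot> (\<iota> (Ob C) \<otimes> mul B)
      = ev \<cdot> (\<iota> (Ob C) \<otimes> ev \<otimes> \<iota> (Ob B)) \<cdot> (comul C \<otimes> \<iota> (Ob B \<odot> Ob B))"
    and ev_one_left: "ev \<cdot> (one C \<otimes> \<iota> (Ob B)) = counit B"
    and ev_one_right: "ev \<cdot> (\<iota> (Ob C) \<otimes> one B) = counit C"
    and ev_antipode: "ev \<cdot> (antipode C \<otimes> \<iota> (Ob B)) = ev \<cdot> (\<iota> (Ob C) \<otimes> antipode B)"


section \<open>Objects with a left and a right action\<close>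

text \<open>
  \<open>Lact V : C \<otimes> V \<rightarrow> V\<close> and \<open>Ract V : V \<otimes> B \<rightarrow> V\<close>; no compatibility between the two
  actions is part of \<open>is_bimod\<close>. An arrow is a triple of source, underlying arrow and target.
\<close>

record ('o, 'a) bimod =
  Und :: "'o"
  Lact :: "'a"
  Ract :: "'a"

record ('o, 'a) bimod_arrow =
  Src :: "('o, 'a) bimod"
  Map :: "'a"
  Tgt :: "('o, 'a) bimod"

context
  fixes M :: "('o, 'a, 'm) braided_category_scheme" (structure)
    and C :: "('o, 'a) hopf"
    and B :: "('o, 'a) hopf"
    and ev :: "'a"
begin

definition is_bimod :: "('o, 'a) bimod \<Rightarrow> bool" where
  "is_bimod V \<longleftrightarrow>
    Und V \<in> Obj M \<and>
    Lact V \<in> hom M (Ob C \<odot> Und V) (Und V) \<and>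
    Lact V \<cdot> (mul C \<otimes> \<iota> (Und V)) = Lact V \<cdot> (\<iota> (Ob C) \<otimes> Lact V) \<and>
    Lact V \<cdot> (one C \<otimes> \<iota> (Und V)) = \<iota> (Und V) \<and>
    Ract V \<in> hom M (Und V \<odot> Ob B) (Und V) \<and>
    Ract V \<cdot> (\<iota> (Und V) \<otimes> mul B) = Ract V \<cdot> (Ract V \<otimes> \<iota> (Ob B)) \<and>
    Ract V \<cdot> (\<iota> (Und V) \<otimes> one B) = \<iota> (Und V)"

definition yd_condition :: "('o, 'a) bimod \<Rightarrow> bool" where
  "yd_condition V \<longleftrightarrow>
    (ev \<otimes> Ract V)
      \<cdot> (\<iota> (Ob C) \<otimes> \<Psi> (Und V) (Ob B) \<otimes> \<iota> (Ob B))
      \<cdot> (\<iota> (Ob C) \<otimes> Lact V \<otimes> \<iota> (Ob B \<odot> Ob B))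
      \<cdot> (comul C \<otimes> \<iota> (Und V) \<otimes> comul B)
    = (Lact V \<otimes> ev)
      \<cdot> (\<iota> (Ob C) \<otimes> \<Psi> (Ob C) (Und V) \<otimes> \<iota> (Ob B))
      \<cdot> (\<iota> (Ob C \<odot> Ob C) \<otimes> Ract V \<otimes> \<iota> (Ob B))
      \<cdot> (comul C \<otimes> \<iota> (Und V) \<otimes> comul B)"

definition h_condition :: "('o, 'a) bimod \<Rightarrow> bool" where
  "h_condition V \<longleftrightarrow>
    Lact V \<cdot> (\<iota> (Ob C) \<otimes> Ract V)
    = (ev \<otimes> Ract V)
      \<cdot> (\<iota> (Ob C) \<otimes> \<Psi> (Und V) (Ob B) \<otimes> \<iota> (Ob B))
      \<cdot> (\<iota> (Ob C) \<otimes> Lact V \<otimes> \<iota> (Ob B \<odot> Ob B))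
      \<cdot> (comul C \<otimes> \<iota> (Und V) \<otimes> comul B)"

definition bimod_arrows :: "('o, 'a) bimod set \<Rightarrow> ('o, 'a) bimod_arrow set" where
  "bimod_arrows \<O> = {\<phi>. Src \<phi> \<in> \<O> \<and> Tgt \<phi> \<in> \<O> \<and>
    Map \<phi> \<in> hom M (Und (Src \<phi>)) (Und (Tgt \<phi>)) \<and>
    Map \<phi> \<cdot> Lact (Src \<phi>) = Lact (Tgt \<phi>) \<cdot> (\<iota> (Ob C) \<otimes> Map \<phi>) \<and>
    Map \<phi> \<cdot> Ract (Src \<phi>) = Ract (Tgt \<phi>) \<cdot> (Map \<phi> \<otimes> \<iota> (Ob B))}"

definition bimod_ident :: "('o, 'a) bimod \<Rightarrow> ('o, 'a) bimod_arrow" where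
  "bimod_ident V = \<lparr>Src = V, Map = \<iota> (Und V), Tgt = V\<rparr>"

definition bimod_comp ::
    "('o, 'a) bimod_arrow \<Rightarrow> ('o, 'a) bimod_arrow \<Rightarrow> ('o, 'a) bimod_arrow" where
  "bimod_comp \<psi> \<phi> = \<lparr>Src = Src \<phi>, Map = Map \<psi> \<cdot> Map \<phi>, Tgt = Tgt \<psi>\<rparr>"

definition bimod_unit :: "('o, 'a) bimod" where
  "bimod_unit = \<lparr>Und = \<I>, Lact = counit C, Ract = counit B\<rparr>"

definition bimod_tensor :: "('o, 'a) bimod \<Rightarrow> ('o, 'a) bimod \<Rightarrow> ('o, 'a) bimod" where
  "bimod_tensor V W = \<lparr>
    Und = Und V \<odot> Und W,
    Lact = (Lact V \<otimes> Lact W)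
      \<cdot> (\<iota> (Ob C) \<otimes> \<Psi> (Ob C) (Und V) \<otimes> \<iota> (Und W))
      \<cdot> (comul C \<otimes> \<iota> (Und V \<odot> Und W)),
    Ract = (Ract V \<otimes> Ract W)
      \<cdot> (\<iota> (Und V) \<otimes> \<Psi> (Und W) (Ob B) \<otimes> \<iota> (Ob B))
      \<cdot> (\<iota> (Und V \<odot> Und W) \<otimes> comul B)\<rparr>"

definition bimod_tensor_arrow ::
    "('o, 'a) bimod_arrow \<Rightarrow> ('o, 'a) bimod_arrow \<Rightarrow> ('o, 'a) bimod_arrow" where
  "bimod_tensor_arrow \<phi> \<psi> = \<lparr>
    Src = bimod_tensor (Src \<phi>) (Src \<psi>),
    Map = Map \<phi> \<otimes> Map \<psi>,
    Tgt = bimod_tensor (Tgt \<phi>) (Tgt \<psi>)\<rparr>"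

definition YD_category :: "(('o, 'a) bimod, ('o, 'a) bimod_arrow) monoidal_category" where
  "YD_category = \<lparr>
    Obj = {V. is_bimod V \<and> yd_condition V},
    Arr = bimod_arrows {V. is_bimod V \<and> yd_condition V},
    Dom = Src,
    Cod = Tgt,
    Ident = bimod_ident,
    Comp = bimod_comp,
    Unit = bimod_unit,
    TensorO = bimod_tensor,
    TensorA = bimod_tensor_arrow\<rparr>"

definition H_category :: "(('o, 'a) bimod, ('o, 'a) bimod_arrow) category" where
  "H_category = \<lparr>
    Obj = {V. is_bimod V \<and> h_condition V},
    Arr = bimod_arrows {V. is_bimod V \<and> h_condition V},
    Dom = Src,
    Cod = Tgt,
    Ident = bimod_ident,
    Comp = bimod_comp\<rparr>"

end

end

theory Submission
  imports Defs
begin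

text \<open>
  In Sweedler notation, with braidings suppressed, the proof is a one-line computation. For a
  Yetter--Drinfeld object \<open>V\<close> and an object \<open>W\<close> of the Heisenberg type,
  \<open>c (v b1 \<otimes> w b2) = c1 (v b1) \<otimes> c2 (w b2) = c1 (v b1) \<otimes> ev(c2, b2) (c3 w) b3
    = ev(c1, b1) (c2 v) b2 \<otimes> (c3 w) b3\<close>,
  where the second step is the condition on \<open>W\<close> and the third one is the condition on \<open>V\<close>.

  To keep track of the braidings, all maps are organised by one binary operation, called \<open>conv\<close>.
  For comultiplications on \<open>c\<close> and \<open>b\<close>, it sends \<open>X : c \<otimes> V \<otimes> b \<rightarrow> V'\<close> and \<open>Y : c \<otimes> W \<otimes> b \<rightarrow> W'\<close> to
  \<open>X * Y : c \<otimes> V \<otimes> W \<otimes> b \<rightarrow> V' \<otimes> W'\<close>, which splits \<open>c\<close> and \<open>b\<close>, hands the outer copies to their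
  neighbours and braids the inner copies across. Taking \<open>b = I\<close> gives the left action on a tensor
  product, taking \<open>c = I\<close> gives the right action. Three facts about \<open>*\<close> carry everything:

  \<^item> it is associative when the comultiplications are coassociative (\<open>conv_assoc\<close>), and counits give
    its unit (\<open>conv_unit_left\<close>, \<open>conv_unit_right\<close>);
  \<^item> it is natural with respect to morphisms of comultiplications (\<open>conv_pre\<close>);
  \<^item> plugging one such product into another gives such a product again, over the tensor product of
    the comultiplications (\<open>conv_comp\<close>).

  The last two show that tensor products of modules are modules. The last one alone also shows that
  \<open>N V\<close>, which is \<open>c (v b)\<close>, and \<open>T V\<close>, which is \<open>(c v) b\<close>, are multiplicative:
  \<open>N (V \<otimes> W) = N V * N W\<close> and \<open>T (V \<otimes> W) = T V * T W\<close>. The two compatibility conditions become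
  \<open>ev * T V = N V * ev\<close> for Yetter--Drinfeld objects and \<open>N W = ev * T W\<close> for the objects acted
  upon, so that the computation above reads
  \<open>N (V \<otimes> W) = N V * ev * T W = ev * T V * T W = ev * T (V \<otimes> W)\<close>.
  As the tensor product of bimodules is strictly associative and unital, the structure morphisms of
  the module category are identities and its coherence axioms are immediate.
\<close>

section \<open>Equational reasoning in strict monoidal categories\<close>

text \<open>
  Membership in hom-sets is split into \<open>Arr\<close>, \<open>Dom\<close> and \<open>Cod\<close>, which the simplifier computes
  bottom-up. With backward rules for hom-sets, the strict associativity of \<open>\<odot>\<close> on objects would
  prevent unification.
\<close>

context category begin

lemma in_hom: "f \<in> hom M X Y \<longleftrightarrow> f \<in> Arr M \<and> Dom M f = X \<and> Cod M f = Y"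
  by (auto simp: hom_def)

lemma hom_Obj: "f \<in> hom M X Y \<Longrightarrow> X \<in> Obj M \<and> Y \<in> Obj M"
  by (auto simp: hom_def Dom_Obj Cod_Obj)

lemma Ident_typing [simp]:
  assumes "X \<in> Obj M"
  shows "\<iota> X \<in> Arr M" "Dom M (\<iota> X) = X" "Cod M (\<iota> X) = X"
  using Ident_hom[OF assms] by (auto simp: hom_def)

lemma Comp_typing [simp]:
  assumes "f \<in> Arr M" "g \<in> Arr M" "Dom M g = Cod M f"
  shows "g \<cdot> f \<in> Arr M" "Dom M (g \<cdot> f) = Dom M f" "Cod M (g \<cdot> f) = Cod M g"
  using Comp_hom[of f "Dom M f" "Cod M f" g "Cod M g"] assms by (auto simp: hom_def)

lemma Comp_Ident' [simp]: "f \<in> Arr M \<Longrightarrow> Dom M f = X \<Longrightarrow> f \<cdot> \<iota> X = f"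
  using Comp_Ident by (auto simp: hom_def)

lemma Ident_Comp' [simp]: "f \<in> Arr M \<Longrightarrow> Cod M f = X \<Longrightarrow> \<iota> X \<cdot> f = f"
  using Ident_Comp by (auto simp: hom_def)

lemma Comp_assoc' [simp]: "f \<in> Arr M \<Longrightarrow> g \<in> Arr M \<Longrightarrow> h \<in> Arr M
    \<Longrightarrow> Dom M g = Cod M f \<Longrightarrow> Dom M h = Cod M g \<Longrightarrow> (h \<cdot> g) \<cdot> f = h \<cdot> g \<cdot> f"
  using Comp_assoc[of f "Dom M f" "Cod M f" g "Cod M g" h "Cod M h"] by (auto simp: hom_def)

lemma Dom_Cod_Obj [simp]: "f \<in> Arr M \<Longrightarrow> Dom M f \<in> Obj M" "f \<in> Arr M \<Longrightarrow> Cod M f \<in> Obj M"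
  by (auto intro: Dom_Obj Cod_Obj)

lemma iso_Ident: "X \<in> Obj M \<Longrightarrow> iso M (\<iota> X)"
  by (auto simp: iso_def in_hom intro!: bexI[of _ "\<iota> X"])

lemma iso_idem:
  assumes "iso M f" "f \<cdot> f = f" "Dom M f = X" "Cod M f = X"
  shows "f = \<iota> X"
proof -
  obtain g where g: "g \<in> hom M X X" "g \<cdot> f = \<iota> X" and f: "f \<in> Arr M"
    using assms by (auto simp: iso_def)
  have "f = (g \<cdot> f) \<cdot> f" using f assms g by (auto simp: hom_def)
  also have "\<dots> = g \<cdot> f" using f assms g(1) by (auto simp del: g(2) simp: hom_def)
  finally show ?thesis using g by simp
qed

text \<open>
  Composites are kept bracketed to the right. An equation for \<open>f \<cdot> g\<close> needs this form to be applied in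
  the middle of a composite.
\<close>

lemma Comp_eq_tail:
  assumes "f \<cdot> g = k" "f \<in> Arr M" "g \<in> Arr M" "Dom M f = Cod M g" "h \<in> Arr M" "Dom M g = Cod M h"
  shows "f \<cdot> g \<cdot> h = k \<cdot> h"
  using assms(2-) by (simp flip: assms(1))

end

context strict_monoidal_category begin

lemmas Obj_closed [simp] = Unit_Obj TensorO_Obj

lemma TensorA_typing [simp]:
  assumes "f \<in> Arr M" "g \<in> Arr M"
  shows "f \<otimes> g \<in> Arr M" "Dom M (f \<otimes> g) = Dom M f \<odot> Dom M g" "Cod M (f \<otimes> g) = Cod M f \<odot> Cod M g"
  using TensorA_hom[of f "Dom M f" "Cod M f" g "Dom M g" "Cod M g"] assms by (auto simp: hom_def)

lemmas strict_simps [simp] = TensorO_assoc TensorO_Unit_left TensorO_Unit_right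
  TensorA_assoc TensorA_Unit_left TensorA_Unit_right

text \<open>
  Identities are split into identities of the single tensor factors, so that a tensor product of
  arrows has the same normal form however its identity strands are grouped.
\<close>

lemma Ident_TensorO [simp]: "X \<in> Obj M \<Longrightarrow> Y \<in> Obj M \<Longrightarrow> \<iota> (X \<odot> Y) = \<iota> X \<otimes> \<iota> Y"
  by (simp add: TensorA_Ident)

lemma interchange:
  assumes "f \<in> Arr M" "f' \<in> Arr M" "Dom M f' = Cod M f" "g \<in> Arr M" "g' \<in> Arr M" "Dom M g' = Cod M g"
  shows "(f' \<otimes> g') \<cdot> (f \<otimes> g) = (f' \<cdot> f) \<otimes> (g' \<cdot> g)"
  using TensorA_Comp[of f "Dom M f" "Cod M f" f' "Cod M f'" g "Dom M g" "Cod M g" g' "Cod M g'"] assms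
  by (auto simp: hom_def)

lemma interchange_tail:
  assumes "f \<in> Arr M" "f' \<in> Arr M" "Dom M f' = Cod M f" "g \<in> Arr M" "g' \<in> Arr M" "Dom M g' = Cod M g"
    and "h \<in> Arr M" "Cod M h = Dom M f \<odot> Dom M g"
  shows "(f' \<otimes> g') \<cdot> (f \<otimes> g) \<cdot> h = ((f' \<cdot> f) \<otimes> (g' \<cdot> g)) \<cdot> h"
  by (rule Comp_eq_tail) (use assms in \<open>simp_all add: interchange\<close>)

lemma interchange3:
  assumes "f \<in> Arr M" "f' \<in> Arr M" "Dom M f' = Cod M f" "g \<in> Arr M" "g' \<in> Arr M" "Dom M g' = Cod M g"
    and "h \<in> Arr M" "h' \<in> Arr M" "Dom M h' = Cod M h"
  shows "(f' \<otimes> g' \<otimes> h') \<cdot> (f \<otimes> g \<otimes> h) = (f' \<cdot> f) \<otimes> (g' \<cdot> g) \<otimes> (h' \<cdot> h)"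
  using assms by (simp add: interchange)

text \<open>
  Used as rewrite rules, these equations pull compositions out of tensor factors and so cut a diagram
  into horizontal layers. They are opposite to \<open>interchange\<close>, which merges layers.
\<close>

lemma layers:
  assumes "f \<in> Arr M" "f' \<in> Arr M" "Dom M f' = Cod M f" "g \<in> Arr M"
  shows "g \<otimes> (f' \<cdot> f) = (\<iota> (Cod M g) \<otimes> f') \<cdot> (g \<otimes> f)"
    "(f' \<cdot> f) \<otimes> g = (f' \<otimes> \<iota> (Cod M g)) \<cdot> (f \<otimes> g)"
  using assms by (simp_all add: interchange)

text \<open>
  The identity laws, restated for identities that \<open>Ident_TensorO\<close> has split.
\<close>

lemma Ident_tensors_Comp [simp]:
  assumes "X \<in> Obj M" "Y \<in> Obj M" "f \<in> Arr M"
  shows "Cod M f = X \<odot> Y \<Longrightarrow> (\<iota> X \<otimes> \<iota> Y) \<cdot> f = f"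
    "Z \<in> Obj M \<Longrightarrow> Cod M f = X \<odot> Y \<odot> Z \<Longrightarrow> (\<iota> X \<otimes> \<iota> Y \<otimes> \<iota> Z) \<cdot> f = f"
    "Z \<in> Obj M \<Longrightarrow> W \<in> Obj M \<Longrightarrow> Cod M f = X \<odot> Y \<odot> Z \<odot> W \<Longrightarrow> (\<iota> X \<otimes> \<iota> Y \<otimes> \<iota> Z \<otimes> \<iota> W) \<cdot> f = f"
    "Z \<in> Obj M \<Longrightarrow> W \<in> Obj M \<Longrightarrow> U \<in> Obj M \<Longrightarrow> Cod M f = X \<odot> Y \<odot> Z \<odot> W \<odot> U
      \<Longrightarrow> (\<iota> X \<otimes> \<iota> Y \<otimes> \<iota> Z \<otimes> \<iota> W \<otimes> \<iota> U) \<cdot> f = f"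
  using assms by (simp_all flip: Ident_TensorO)

lemma Comp_Ident_tensors [simp]:
  assumes "X \<in> Obj M" "Y \<in> Obj M" "f \<in> Arr M"
  shows "Dom M f = X \<odot> Y \<Longrightarrow> f \<cdot> (\<iota> X \<otimes> \<iota> Y) = f"
    "Z \<in> Obj M \<Longrightarrow> Dom M f = X \<odot> Y \<odot> Z \<Longrightarrow> f \<cdot> (\<iota> X \<otimes> \<iota> Y \<otimes> \<iota> Z) = f"
    "Z \<in> Obj M \<Longrightarrow> W \<in> Obj M \<Longrightarrow> Dom M f = X \<odot> Y \<odot> Z \<odot> W \<Longrightarrow> f \<cdot> (\<iota> X \<otimes> \<iota> Y \<otimes> \<iota> Z \<otimes> \<iota> W) = f"
    "Z \<in> Obj M \<Longrightarrow> W \<in> Obj M \<Longrightarrow> U \<in> Obj M \<Longrightarrow> Dom M f = X \<odot> Y \<odot> Z \<odot> W \<odot> U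
      \<Longrightarrow> f \<cdot> (\<iota> X \<otimes> \<iota> Y \<otimes> \<iota> Z \<otimes> \<iota> W \<otimes> \<iota> U) = f"
  using assms by (simp_all flip: Ident_TensorO)

lemma whisker_eq:
  assumes eq: "f' \<cdot> f = g' \<cdot> g" and "f \<in> Arr M" "f' \<in> Arr M" "Dom M f' = Cod M f"
   "g \<in> Arr M" "g' \<in> Arr M" "Dom M g' = Cod M g" "X \<in> Obj M" "Y \<in> Obj M"
  shows "(\<iota> X \<otimes> f' \<otimes> \<iota> Y) \<cdot> (\<iota> X \<otimes> f \<otimes> \<iota> Y) = (\<iota> X \<otimes> g' \<otimes> \<iota> Y) \<cdot> (\<iota> X \<otimes> g \<otimes> \<iota> Y)"
  using assms by (simp add: interchange)

lemma slide:
  assumes "f \<in> Arr M" "g \<in> Arr M"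
  shows "(f \<otimes> \<iota> (Cod M g)) \<cdot> (\<iota> (Dom M f) \<otimes> g) = (\<iota> (Cod M f) \<otimes> g) \<cdot> (f \<otimes> \<iota> (Dom M g))"
  using assms by (simp add: interchange)

end

section \<open>Braid identities\<close>

context braided_monoidal_category begin

lemma Braid_typing [simp]:
  assumes "X \<in> Obj M" "Y \<in> Obj M"
  shows "\<Psi> X Y \<in> Arr M" "Dom M (\<Psi> X Y) = X \<odot> Y" "Cod M (\<Psi> X Y) = Y \<odot> X"
  using Braid_hom[OF assms] by (auto simp: hom_def)

lemma natural:
  assumes "f \<in> Arr M" "g \<in> Arr M"
  shows "\<Psi> (Cod M f) (Cod M g) \<cdot> (f \<otimes> g) = (g \<otimes> f) \<cdot> \<Psi> (Dom M f) (Dom M g)"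
  using Braid_natural[of f "Dom M f" "Cod M f" g "Dom M g" "Cod M g"] assms by (auto simp: hom_def)

text \<open>
  The hexagon identity for \<open>X\<close>, \<open>\<I>\<close>, \<open>\<I>\<close> makes the braiding with the unit idempotent, and an
  idempotent isomorphism is an identity.
\<close>

lemma Braid_Unit [simp]:
  assumes X: "X \<in> Obj M"
  shows "\<Psi> X \<I> = \<iota> X" "\<Psi> \<I> X = \<iota> X"
proof -
  show "\<Psi> X \<I> = \<iota> X"
    using Braid_TensorO_right[of X \<I> \<I>] Braid_iso[of X \<I>] X by (intro iso_idem) simp_all
  show "\<Psi> \<I> X = \<iota> X"
    using Braid_TensorO_left[of \<I> \<I> X] Braid_iso[of \<I> X] X by (intro iso_idem) simp_all
qed

text \<open>
  The middle part of \<open>conv\<close>: of the strands \<open>c, V, W, b\<close>, first \<open>c\<close> crosses \<open>V\<close>, then \<open>c\<close> and \<open>W\<close>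
  together cross \<open>b\<close>, ending in the order \<open>V, b, c, W\<close>.
\<close>

definition shuffle :: "'o \<Rightarrow> 'o \<Rightarrow> 'o \<Rightarrow> 'o \<Rightarrow> 'a" where
  "shuffle c V W b = (\<iota> V \<otimes> \<Psi> (c \<odot> W) b) \<cdot> (\<Psi> c V \<otimes> \<iota> (W \<odot> b))"

lemma shuffle_typing [simp]:
  assumes "c \<in> Obj M" "V \<in> Obj M" "W \<in> Obj M" "b \<in> Obj M"
  shows "shuffle c V W b \<in> Arr M" "Dom M (shuffle c V W b) = c \<odot> V \<odot> W \<odot> b"
    "Cod M (shuffle c V W b) = V \<odot> b \<odot> c \<odot> W"
  using assms by (simp_all add: shuffle_def)

lemma shuffle_natural:
  assumes "h \<in> hom M c c'" "f \<in> hom M V V'" "g \<in> hom M W W'" "k \<in> hom M b b'"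
  shows "shuffle c' V' W' b' \<cdot> (h \<otimes> f \<otimes> g \<otimes> k) = (f \<otimes> k \<otimes> h \<otimes> g) \<cdot> shuffle c V W b"
proof -
  note [simp] = assms[unfolded in_hom] assms[THEN hom_Obj]
  have "shuffle c' V' W' b' \<cdot> (h \<otimes> f \<otimes> g \<otimes> k)
    = (\<iota> V' \<otimes> \<Psi> (c' \<odot> W') b') \<cdot> (\<Psi> c' V' \<otimes> \<iota> (W' \<odot> b')) \<cdot> ((h \<otimes> f) \<otimes> (g \<otimes> k))"
    by (simp add: shuffle_def)
  also have "\<dots> = (\<iota> V' \<otimes> \<Psi> (c' \<odot> W') b') \<cdot> ((\<Psi> c' V' \<cdot> (h \<otimes> f)) \<otimes> (g \<otimes> k))"
    by (subst interchange) (simp_all add: interchange)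
  also have "\<dots> = (\<iota> V' \<otimes> \<Psi> (c' \<odot> W') b') \<cdot> (((f \<otimes> h) \<cdot> \<Psi> c V) \<otimes> (g \<otimes> k))"
    using natural[of h f] by simp
  also have "\<dots> = (\<iota> V' \<otimes> \<Psi> (c' \<odot> W') b') \<cdot> ((f \<otimes> (h \<otimes> g) \<otimes> k)) \<cdot> (\<Psi> c V \<otimes> \<iota> (W \<odot> b))"
    using interchange[of "\<Psi> c V" "f \<otimes> h" "\<iota> (W \<odot> b)" "g \<otimes> k"] by (simp add: interchange)
  also have "\<dots> = (f \<otimes> (\<Psi> (c' \<odot> W') b' \<cdot> ((h \<otimes> g) \<otimes> k))) \<cdot> (\<Psi> c V \<otimes> \<iota> (W \<odot> b))"
    by (subst interchange_tail) simp_all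
  also have "\<dots> = (f \<otimes> ((k \<otimes> (h \<otimes> g)) \<cdot> \<Psi> (c \<odot> W) b)) \<cdot> (\<Psi> c V \<otimes> \<iota> (W \<odot> b))"
    using natural[of "h \<otimes> g" k] by simp
  also have "\<dots> = (f \<otimes> k \<otimes> h \<otimes> g) \<cdot> shuffle c V W b"
    by (simp add: shuffle_def interchange_tail)
  finally show ?thesis .
qed

text \<open>
  Both sides let \<open>X\<close> and \<open>Y\<close> cross \<open>P\<close>, and \<open>Y\<close> also cross \<open>Q\<close>. They differ only in the order of two
  crossings without a common strand: \<open>X\<close> with \<open>P\<close>, and \<open>Y\<close> with \<open>Q\<close>.
\<close>

lemma Braid_corner:
  assumes [simp]: "X \<in> Obj M" "Y \<in> Obj M" "P \<in> Obj M" "Q \<in> Obj M"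
  shows "(\<iota> (P \<odot> X) \<otimes> \<Psi> Y Q) \<cdot> (\<Psi> (X \<odot> Y) P \<otimes> \<iota> Q)
    = (\<Psi> X P \<otimes> \<iota> (Q \<odot> Y)) \<cdot> (\<iota> X \<otimes> \<Psi> Y (P \<odot> Q))"
proof -
  have "(\<iota> (P \<odot> X) \<otimes> \<Psi> Y Q) \<cdot> (\<Psi> (X \<odot> Y) P \<otimes> \<iota> Q)
    = ((\<iota> (P \<odot> X) \<otimes> \<Psi> Y Q) \<cdot> (\<Psi> X P \<otimes> \<iota> (Y \<odot> Q))) \<cdot> (\<iota> X \<otimes> \<Psi> Y P \<otimes> \<iota> Q)"
    by (simp add: Braid_TensorO_left layers)
  also have "\<dots> = ((\<Psi> X P \<otimes> \<iota> (Q \<odot> Y)) \<cdot> (\<iota> (X \<odot> P) \<otimes> \<Psi> Y Q)) \<cdot> (\<iota> X \<otimes> \<Psi> Y P \<otimes> \<iota> Q)"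
    using slide[of "\<Psi> X P" "\<Psi> Y Q"] by simp
  also have "\<dots> = (\<Psi> X P \<otimes> \<iota> (Q \<odot> Y)) \<cdot> (\<iota> X \<otimes> \<Psi> Y (P \<odot> Q))"
    by (simp add: Braid_TensorO_right layers)
  finally show ?thesis .
qed

text \<open>
  The braid identity behind associativity of \<open>conv\<close>. Both sides permute the strands
  \<open>x y U V W p q\<close> to \<open>U p x V q y W\<close>. On the left \<open>y\<close> crosses \<open>V\<close> before the two meet \<open>p\<close>, on the right
  afterwards; naturality of the braiding with \<open>p\<close> exchanges this (\<open>e1\<close>). The other differences are two
  instances of \<open>Braid_corner\<close> and one exchange of disjoint crossings.
\<close>

lemma shuffle_assoc:
  assumes [simp]: "x \<in> Obj M" "y \<in> Obj M" "U \<in> Obj M" "V \<in> Obj M" "W \<in> Obj M" "p \<in> Obj M" "q \<in> Obj M"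
  shows "(shuffle x U V p \<otimes> \<iota> (q \<odot> y \<odot> W)) \<cdot> (\<iota> x \<otimes> shuffle y (U \<odot> V) W (p \<odot> q))
    = (\<iota> (U \<odot> p \<odot> x) \<otimes> shuffle y V W q) \<cdot> (shuffle (x \<odot> y) U (V \<odot> W) p \<otimes> \<iota> q)"
    (is "?l = ?r")
proof -
  let ?A4 = "\<iota> U \<otimes> \<Psi> (x \<odot> V) p \<otimes> \<iota> (q \<odot> y \<odot> W)"
  let ?A3 = "\<Psi> x U \<otimes> \<iota> (V \<odot> p \<odot> q \<odot> y \<odot> W)"
  let ?A2 = "\<iota> (x \<odot> U \<odot> V) \<otimes> \<Psi> (y \<odot> W) (p \<odot> q)"
  let ?A1 = "\<iota> x \<otimes> \<Psi> y (U \<odot> V) \<otimes> \<iota> (W \<odot> p \<odot> q)"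
  let ?A2' = "\<iota> (U \<odot> x \<odot> V) \<otimes> \<Psi> (y \<odot> W) (p \<odot> q)"
  let ?A3' = "\<Psi> x U \<otimes> \<iota> (V \<odot> y \<odot> W \<odot> p \<odot> q)"
  let ?B4 = "\<iota> (U \<odot> p \<odot> x \<odot> V) \<otimes> \<Psi> (y \<odot> W) q"
  let ?B3 = "\<iota> (U \<odot> p \<odot> x) \<otimes> \<Psi> y V \<otimes> \<iota> (W \<odot> q)"
  let ?B2 = "\<iota> U \<otimes> \<Psi> (x \<odot> y \<odot> V \<odot> W) p \<otimes> \<iota> q"
  let ?B1 = "\<Psi> (x \<odot> y) U \<otimes> \<iota> (V \<odot> W \<odot> p \<odot> q)"
  let ?D = "\<iota> U \<otimes> \<Psi> (x \<odot> V \<odot> y \<odot> W) p \<otimes> \<iota> q"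
  let ?E = "\<iota> (U \<odot> x) \<otimes> \<Psi> y V \<otimes> \<iota> (W \<odot> p \<odot> q)"
  have e0: "?A3 \<cdot> ?A2 = ?A2' \<cdot> ?A3'"
    using slide[of "\<Psi> x U" "\<iota> V \<otimes> \<Psi> (y \<odot> W) (p \<odot> q)"] by simp
  have e1: "?B3 \<cdot> ?B2 = ?D \<cdot> ?E"
    using whisker_eq[OF natural[of "\<iota> x \<otimes> \<Psi> y V \<otimes> \<iota> W" "\<iota> p"], of U q] by simp
  have e2: "?E \<cdot> ?B1 = ?A3' \<cdot> ?A1"
    using whisker_eq[OF Braid_corner[of x y U V], of \<I> "W \<odot> p \<odot> q"] by simp
  have e3: "?B4 \<cdot> ?D = ?A4 \<cdot> ?A2'"
    using whisker_eq[OF Braid_corner[of "x \<odot> V" "y \<odot> W" p q], of U \<I>] by simp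
  have "?l = ?A4 \<cdot> (?A3 \<cdot> ?A2) \<cdot> ?A1"
    by (simp add: shuffle_def layers)
  also have "\<dots> = (?A4 \<cdot> ?A2') \<cdot> (?A3' \<cdot> ?A1)"
    unfolding e0 by simp
  also have "\<dots> = ?B4 \<cdot> (?D \<cdot> ?E) \<cdot> ?B1"
    unfolding e2[symmetric] e3[symmetric] by simp
  also have "\<dots> = ?r"
    unfolding e1[symmetric] by (simp add: shuffle_def layers)
  finally show ?thesis .
qed

lemma shuffle_left:
  assumes [simp]: "x \<in> Obj M" "z \<in> Obj M" "V \<in> Obj M" "W \<in> Obj M" "p \<in> Obj M"
  shows "shuffle (x \<odot> z) V W p = (\<Psi> x (V \<odot> p) \<otimes> \<iota> (z \<odot> W)) \<cdot> (\<iota> x \<otimes> shuffle z V W p)"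
proof -
  let ?a = "\<iota> V \<otimes> \<Psi> x p \<otimes> \<iota> (z \<odot> W)" and ?b = "\<iota> x \<otimes> \<Psi> z V \<otimes> \<iota> (W \<odot> p)"
  have "shuffle (x \<odot> z) V W p
    = ?a \<cdot> ((\<iota> (V \<odot> x) \<otimes> \<Psi> (z \<odot> W) p) \<cdot> (\<Psi> x V \<otimes> \<iota> (z \<odot> W \<odot> p))) \<cdot> ?b"
    using Braid_TensorO_left[of x "z \<odot> W" p] by (simp add: shuffle_def layers Braid_TensorO_left[of x z V])
  also have "\<dots> = ?a \<cdot> ((\<Psi> x V \<otimes> \<iota> (p \<odot> z \<odot> W)) \<cdot> (\<iota> (x \<odot> V) \<otimes> \<Psi> (z \<odot> W) p)) \<cdot> ?b"
    using slide[of "\<Psi> x V" "\<Psi> (z \<odot> W) p"] by simp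
  also have "\<dots> = (\<Psi> x (V \<odot> p) \<otimes> \<iota> (z \<odot> W)) \<cdot> (\<iota> x \<otimes> shuffle z V W p)"
    by (simp add: shuffle_def layers Braid_TensorO_right)
  finally show ?thesis .
qed

lemma shuffle_right:
  assumes [simp]: "c \<in> Obj M" "V \<in> Obj M" "W \<in> Obj M" "p \<in> Obj M" "r \<in> Obj M"
  shows "shuffle c V W (p \<odot> r) = (\<iota> (V \<odot> p) \<otimes> \<Psi> (c \<odot> W) r) \<cdot> (shuffle c V W p \<otimes> \<iota> r)"
  by (simp add: shuffle_def layers Braid_TensorO_right)

text \<open>
  The braid identity behind \<open>conv_comp\<close>. Both sides permute \<open>x y z V W p q r\<close> to
  \<open>y V p r x z W q\<close>; the right-hand side performs the crossings of \<open>x\<close> with \<open>y\<close> and of \<open>q\<close> with \<open>r\<close>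
  first. Nothing but the hexagon identities and exchanges of disjoint crossings is involved: the
  left-hand side is cut into \<open>\<Psi> x y\<close>, \<open>\<Psi> q r\<close> and the rest, and the first two slide to the
  beginning.
\<close>

lemma shuffle_comp:
  assumes [simp]: "x \<in> Obj M" "y \<in> Obj M" "z \<in> Obj M" "V \<in> Obj M" "W \<in> Obj M"
     "p \<in> Obj M" "q \<in> Obj M" "r \<in> Obj M"
  shows "shuffle x (y \<odot> V \<odot> p) (z \<odot> W \<odot> q) r \<cdot> (\<iota> (x \<odot> y) \<otimes> shuffle z V W p \<otimes> \<iota> (q \<odot> r))
    = (\<iota> y \<otimes> shuffle (x \<odot> z) V W (p \<odot> r) \<otimes> \<iota> q) \<cdot> (\<Psi> x y \<otimes> \<iota> (z \<odot> V \<odot> W \<odot> p) \<otimes> \<Psi> q r)"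
    (is "?l = ?r")
proof -
  let ?S = "shuffle z V W p"
  let ?F = "\<iota> (y \<odot> V \<odot> p) \<otimes> \<Psi> (x \<odot> z \<odot> W) r \<otimes> \<iota> q"
  let ?G = "\<iota> y \<otimes> \<Psi> x (V \<odot> p) \<otimes> \<iota> (z \<odot> W \<odot> r \<odot> q)"
  have 1: "\<Psi> (x \<odot> z \<odot> W \<odot> q) r = (\<Psi> (x \<odot> z \<odot> W) r \<otimes> \<iota> q) \<cdot> (\<iota> (x \<odot> z \<odot> W) \<otimes> \<Psi> q r)"
    using Braid_TensorO_left[of "x \<odot> z \<odot> W" q r] by simp
  have 2: "((\<iota> (y \<odot> V \<odot> p \<odot> x \<odot> z \<odot> W) \<otimes> \<Psi> q r) \<cdot> (\<iota> y \<otimes> \<Psi> x (V \<odot> p) \<otimes> \<iota> (z \<odot> W \<odot> q \<odot> r)))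
     = ?G \<cdot> (\<iota> (y \<odot> x \<odot> V \<odot> p \<odot> z \<odot> W) \<otimes> \<Psi> q r)"
    using slide[of "\<iota> y \<otimes> \<Psi> x (V \<odot> p) \<otimes> \<iota> (z \<odot> W)" "\<Psi> q r"] by simp
  have 3: "(\<iota> (y \<odot> x \<odot> V \<odot> p \<odot> z \<odot> W) \<otimes> \<Psi> q r) \<cdot> (\<Psi> x y \<otimes> \<iota> (V \<odot> p \<odot> z \<odot> W \<odot> q \<odot> r))
        \<cdot> (\<iota> (x \<odot> y) \<otimes> ?S \<otimes> \<iota> (q \<odot> r)) = \<Psi> x y \<otimes> ?S \<otimes> \<Psi> q r"
    using interchange3[of "\<iota> (x \<odot> y)" "\<Psi> x y" ?S "\<iota> (V \<odot> p \<odot> z \<odot> W)" "\<iota> (q \<odot> r)" "\<iota> (q \<odot> r)"]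
      interchange3[of "\<Psi> x y" "\<iota> (y \<odot> x)" ?S "\<iota> (V \<odot> p \<odot> z \<odot> W)" "\<iota> (q \<odot> r)" "\<Psi> q r"]
    by simp
  have 4: "\<Psi> x y \<otimes> ?S \<otimes> \<Psi> q r = (\<iota> (y \<odot> x) \<otimes> ?S \<otimes> \<iota> (r \<odot> q)) \<cdot> (\<Psi> x y \<otimes> \<iota> (z \<odot> V \<odot> W \<odot> p) \<otimes> \<Psi> q r)"
    using interchange3[of "\<Psi> x y" "\<iota> (y \<odot> x)" "\<iota> (z \<odot> V \<odot> W \<odot> p)" ?S "\<Psi> q r" "\<iota> (r \<odot> q)"] by simp
  have 5: "\<Psi> x (y \<odot> V \<odot> p) = (\<iota> y \<otimes> \<Psi> x (V \<odot> p)) \<cdot> (\<Psi> x y \<otimes> \<iota> (V \<odot> p))"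
    using Braid_TensorO_right[of x y "V \<odot> p"] by simp
  have "?l = ?F \<cdot> ((\<iota> (y \<odot> V \<odot> p \<odot> x \<odot> z \<odot> W) \<otimes> \<Psi> q r) \<cdot> (\<iota> y \<otimes> \<Psi> x (V \<odot> p) \<otimes> \<iota> (z \<odot> W \<odot> q \<odot> r)))
     \<cdot> (\<Psi> x y \<otimes> \<iota> (V \<odot> p \<odot> z \<odot> W \<odot> q \<odot> r)) \<cdot> (\<iota> (x \<odot> y) \<otimes> ?S \<otimes> \<iota> (q \<odot> r))"
    by (simp add: shuffle_def[of x] 1 5 layers)
  also have "\<dots> = ?F \<cdot> ?G \<cdot> ((\<iota> (y \<odot> x \<odot> V \<odot> p \<odot> z \<odot> W) \<otimes> \<Psi> q r) \<cdot> (\<Psi> x y \<otimes> \<iota> (V \<odot> p \<odot> z \<odot> W \<odot> q \<odot> r))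
        \<cdot> (\<iota> (x \<odot> y) \<otimes> ?S \<otimes> \<iota> (q \<odot> r)))"
    unfolding 2 by simp
  also have "\<dots> = ?F \<cdot> ?G \<cdot> (\<iota> (y \<odot> x) \<otimes> ?S \<otimes> \<iota> (r \<odot> q)) \<cdot> (\<Psi> x y \<otimes> \<iota> (z \<odot> V \<odot> W \<odot> p) \<otimes> \<Psi> q r)"
    unfolding 3 4 ..
  also have "\<dots> = ?r"
    by (simp add: shuffle_left shuffle_right layers)
  finally show ?thesis .
qed

section \<open>The convolution tensor product\<close>

text \<open>
  Here \<open>dc\<close> and \<open>db\<close> are comultiplications on \<open>Dom dc\<close> and \<open>Dom db\<close>. Putting the identity of the unit
  object for one of them turns this into the tensor product of left, respectively right, actions, so
  that both are covered by the same lemmas. The objects \<open>V\<close> and \<open>W\<close> are arguments because they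
  cannot be recovered from the domains of \<open>X\<close> and \<open>Y\<close>.
\<close>

definition conv :: "'a \<Rightarrow> 'a \<Rightarrow> 'o \<Rightarrow> 'o \<Rightarrow> 'a \<Rightarrow> 'a \<Rightarrow> 'a" where
  "conv dc db V W X Y = (X \<otimes> Y)
    \<cdot> (\<iota> (Dom M dc) \<otimes> shuffle (Dom M dc) V W (Dom M db) \<otimes> \<iota> (Dom M db))
    \<cdot> (dc \<otimes> \<iota> (V \<odot> W) \<otimes> db)"

lemma conv_hom:
  assumes "dc \<in> hom M c (c \<odot> c)" "db \<in> hom M b (b \<odot> b)" "V \<in> Obj M" "W \<in> Obj M"
    "X \<in> hom M (c \<odot> V \<odot> b) V'" "Y \<in> hom M (c \<odot> W \<odot> b) W'"
  shows "conv dc db V W X Y \<in> hom M (c \<odot> V \<odot> W \<odot> b) (V' \<odot> W')"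
proof -
  note [simp] = assms[unfolded in_hom] assms(1,2)[THEN hom_Obj]
  show ?thesis by (simp add: in_hom conv_def)
qed

lemma conv_post:
  assumes "dc \<in> hom M c (c \<odot> c)" "db \<in> hom M b (b \<odot> b)" "V \<in> Obj M" "W \<in> Obj M"
    "X \<in> hom M (c \<odot> V \<odot> b) V'" "Y \<in> hom M (c \<odot> W \<odot> b) W'"
    "f \<in> hom M V' V''" "g \<in> hom M W' W''"
  shows "(f \<otimes> g) \<cdot> conv dc db V W X Y = conv dc db V W (f \<cdot> X) (g \<cdot> Y)"
proof -
  note [simp] = assms[unfolded in_hom] assms(1,2)[THEN hom_Obj]
  show ?thesis by (simp add: conv_def interchange_tail)
qed

text \<open>
  The morphisms \<open>h\<close> and \<open>k\<close> respect the comultiplications, so they can be moved past them, which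
  doubles them, and then past the shuffle by naturality. For \<open>h\<close> the multiplication or the unit of a
  Hopf algebra this is where the bialgebra axioms enter.
\<close>

lemma conv_pre:
  assumes "dc \<in> hom M c (c \<odot> c)" "db \<in> hom M b (b \<odot> b)"
    "dc' \<in> hom M c' (c' \<odot> c')" "db' \<in> hom M b' (b' \<odot> b')"
    "X \<in> hom M (c \<odot> V \<odot> b) V''" "Y \<in> hom M (c \<odot> W \<odot> b) W''"
    "f \<in> hom M V' V" "g \<in> hom M W' W" "h \<in> hom M c' c" "k \<in> hom M b' b"
    and h: "dc \<cdot> h = (h \<otimes> h) \<cdot> dc'" and k: "db \<cdot> k = (k \<otimes> k) \<cdot> db'"
  shows "conv dc db V W X Y \<cdot> (h \<otimes> f \<otimes> g \<otimes> k)
    = conv dc' db' V' W' (X \<cdot> (h \<otimes> f \<otimes> k)) (Y \<cdot> (h \<otimes> g \<otimes> k))"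
proof -
  note [simp] = assms(1-10)[unfolded in_hom] assms(1-10)[THEN hom_Obj]
  have 1: "(dc \<otimes> \<iota> (V \<odot> W) \<otimes> db) \<cdot> (h \<otimes> f \<otimes> g \<otimes> k)
     = (h \<otimes> (h \<otimes> f \<otimes> g \<otimes> k) \<otimes> k) \<cdot> (dc' \<otimes> \<iota> (V' \<odot> W') \<otimes> db')"
    using interchange3[of dc' "h \<otimes> h" "\<iota> (V' \<odot> W')" "f \<otimes> g" db' "k \<otimes> k"] by (simp add: interchange h k)
  have 2: "(\<iota> c \<otimes> shuffle c V W b \<otimes> \<iota> b) \<cdot> (h \<otimes> (h \<otimes> f \<otimes> g \<otimes> k) \<otimes> k)
     = ((h \<otimes> f \<otimes> k) \<otimes> (h \<otimes> g \<otimes> k)) \<cdot> (\<iota> c' \<otimes> shuffle c' V' W' b' \<otimes> \<iota> b')"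
    using shuffle_natural[OF assms(9,7,8,10)]
      interchange3[of h "\<iota> c" "h \<otimes> f \<otimes> g \<otimes> k" "shuffle c V W b" k "\<iota> b"]
      interchange3[of "\<iota> c'" h "shuffle c' V' W' b'" "f \<otimes> k \<otimes> h \<otimes> g" "\<iota> b'" k]
    by simp
  have "conv dc db V W X Y \<cdot> (h \<otimes> f \<otimes> g \<otimes> k)
    = (X \<otimes> Y) \<cdot> (\<iota> c \<otimes> shuffle c V W b \<otimes> \<iota> b) \<cdot> ((dc \<otimes> \<iota> (V \<odot> W) \<otimes> db) \<cdot> (h \<otimes> f \<otimes> g \<otimes> k))"
    by (simp add: conv_def)
  also have "\<dots> = (X \<otimes> Y) \<cdot> ((\<iota> c \<otimes> shuffle c V W b \<otimes> \<iota> b) \<cdot> (h \<otimes> (h \<otimes> f \<otimes> g \<otimes> k) \<otimes> k))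
     \<cdot> (dc' \<otimes> \<iota> (V' \<odot> W') \<otimes> db')"
    unfolding 1 by simp
  also have "\<dots> = ((X \<otimes> Y) \<cdot> ((h \<otimes> f \<otimes> k) \<otimes> (h \<otimes> g \<otimes> k))) \<cdot> (\<iota> c' \<otimes> shuffle c' V' W' b' \<otimes> \<iota> b')
     \<cdot> (dc' \<otimes> \<iota> (V' \<odot> W') \<otimes> db')"
    unfolding 2 by simp
  also have "\<dots> = conv dc' db' V' W' (X \<cdot> (h \<otimes> f \<otimes> k)) (Y \<cdot> (h \<otimes> g \<otimes> k))"
    by (subst interchange) (simp_all add: conv_def)
  finally show ?thesis .
qed

text \<open>
  By naturality of the shuffle, the second comultiplication on either side can be moved next to
  the first one. Both sides then consist of an iterated comultiplication, a braid and \<open>X \<otimes> Y \<otimes> Z\<close>; the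
  iterated comultiplications agree by coassociativity and the braids by \<open>shuffle_assoc\<close>.
\<close>

lemma conv_assoc:
  assumes "dc \<in> hom M c (c \<odot> c)" "db \<in> hom M b (b \<odot> b)"
    "X \<in> hom M (c \<odot> U \<odot> b) U'" "Y \<in> hom M (c \<odot> V \<odot> b) V'" "Z \<in> hom M (c \<odot> W \<odot> b) W'"
    "U \<in> Obj M" "V \<in> Obj M" "W \<in> Obj M"
    and dc: "(dc \<otimes> \<iota> c) \<cdot> dc = (\<iota> c \<otimes> dc) \<cdot> dc" and db: "(db \<otimes> \<iota> b) \<cdot> db = (\<iota> b \<otimes> db) \<cdot> db"
  shows "conv dc db (U \<odot> V) W (conv dc db U V X Y) Z = conv dc db U (V \<odot> W) X (conv dc db V W Y Z)"
    (is "?l = ?r")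
proof -
  note [simp] = assms(1-8)[unfolded in_hom] assms(1-2)[THEN hom_Obj]
  note [simp] = conv_hom[unfolded in_hom, of _ c _ b]
  let ?dl = "((dc \<otimes> \<iota> c) \<cdot> dc) \<otimes> \<iota> (U \<odot> V \<odot> W) \<otimes> ((db \<otimes> \<iota> b) \<cdot> db)"
  let ?dr = "((\<iota> c \<otimes> dc) \<cdot> dc) \<otimes> \<iota> (U \<odot> V \<odot> W) \<otimes> ((\<iota> b \<otimes> db) \<cdot> db)"
  let ?XYZ = "X \<otimes> Y \<otimes> Z"
  let ?sl = "\<iota> c \<otimes> shuffle c U V b \<otimes> \<iota> (b \<odot> c \<odot> W \<odot> b)"
  let ?sl' = "\<iota> (c \<odot> c) \<otimes> shuffle c (U \<odot> V) W (b \<odot> b) \<otimes> \<iota> b"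
  let ?sr = "\<iota> (c \<odot> U \<odot> b \<odot> c) \<otimes> shuffle c V W b \<otimes> \<iota> b"
  let ?sr' = "\<iota> c \<otimes> shuffle (c \<odot> c) U (V \<odot> W) b \<otimes> \<iota> (b \<odot> b)"
  have l1: "conv dc db U V X Y \<otimes> Z = ?XYZ \<cdot> ?sl \<cdot> (dc \<otimes> \<iota> (U \<odot> V) \<otimes> db \<otimes> \<iota> (c \<odot> W \<odot> b))"
    unfolding conv_def
    using interchange[of "(\<iota> c \<otimes> shuffle c U V b \<otimes> \<iota> b) \<cdot> (dc \<otimes> \<iota> (U \<odot> V) \<otimes> db)" "X \<otimes> Y" "\<iota> (c \<odot> W \<odot> b)" Z]
    by (simp add: layers)
  have l2: "(dc \<otimes> (\<iota> (U \<odot> V) \<otimes> db \<otimes> \<iota> (c \<odot> W)) \<otimes> \<iota> b) \<cdot> (\<iota> c \<otimes> shuffle c (U \<odot> V) W b \<otimes> \<iota> b)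
     = ?sl' \<cdot> (dc \<otimes> (\<iota> (c \<odot> U \<odot> V \<odot> W) \<otimes> db) \<otimes> \<iota> b)"
    using shuffle_natural[of "\<iota> c" c c "\<iota> (U \<odot> V)" "U \<odot> V" "U \<odot> V" "\<iota> W" W W db b "b \<odot> b"]
      interchange3[of "\<iota> c" dc "shuffle c (U \<odot> V) W b" "\<iota> (U \<odot> V) \<otimes> db \<otimes> \<iota> (c \<odot> W)" "\<iota> b" "\<iota> b"]
      interchange3[of dc "\<iota> (c \<odot> c)" "\<iota> (c \<odot> U \<odot> V \<odot> W) \<otimes> db" "shuffle c (U \<odot> V) W (b \<odot> b)" "\<iota> b" "\<iota> b"]
    by (simp add: in_hom)
  have l3: "(dc \<otimes> (\<iota> (c \<odot> U \<odot> V \<odot> W) \<otimes> db) \<otimes> \<iota> b) \<cdot> (dc \<otimes> \<iota> (U \<odot> V \<odot> W) \<otimes> db) = ?dl"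
    using interchange3[of dc "dc \<otimes> \<iota> c" "\<iota> (U \<odot> V \<odot> W)" "\<iota> (U \<odot> V \<odot> W)" db "db \<otimes> \<iota> b"] by simp
  have "?l = ?XYZ \<cdot> ?sl \<cdot> ((dc \<otimes> (\<iota> (U \<odot> V) \<otimes> db \<otimes> \<iota> (c \<odot> W)) \<otimes> \<iota> b) \<cdot> (\<iota> c \<otimes> shuffle c (U \<odot> V) W b \<otimes> \<iota> b))
     \<cdot> (dc \<otimes> \<iota> (U \<odot> V \<odot> W) \<otimes> db)"
    unfolding conv_def[of _ _ "U \<odot> V"] l1 by simp
  also have "\<dots> = ?XYZ \<cdot> (?sl \<cdot> ?sl') \<cdot> ?dl"
    unfolding l2 l3[symmetric] by simp
  finally have l: "?l = ?XYZ \<cdot> (?sl \<cdot> ?sl') \<cdot> ?dl" .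
  have r1: "X \<otimes> conv dc db V W Y Z = ?XYZ \<cdot> ?sr \<cdot> (\<iota> (c \<odot> U \<odot> b) \<otimes> dc \<otimes> \<iota> (V \<odot> W) \<otimes> db)"
    unfolding conv_def
    using interchange[of "\<iota> (c \<odot> U \<odot> b)" X "(\<iota> c \<otimes> shuffle c V W b \<otimes> \<iota> b) \<cdot> (dc \<otimes> \<iota> (V \<odot> W) \<otimes> db)" "Y \<otimes> Z"]
    by (simp add: layers)
  have r2: "(\<iota> c \<otimes> (\<iota> (U \<odot> b) \<otimes> dc \<otimes> \<iota> (V \<odot> W)) \<otimes> db) \<cdot> (\<iota> c \<otimes> shuffle c U (V \<odot> W) b \<otimes> \<iota> b)
     = ?sr' \<cdot> (\<iota> c \<otimes> (dc \<otimes> \<iota> (U \<odot> V \<odot> W \<odot> b)) \<otimes> db)"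
    using shuffle_natural[of dc c "c \<odot> c" "\<iota> U" U U "\<iota> (V \<odot> W)" "V \<odot> W" "V \<odot> W" "\<iota> b" b b]
      interchange3[of "\<iota> c" "\<iota> c" "shuffle c U (V \<odot> W) b" "\<iota> (U \<odot> b) \<otimes> dc \<otimes> \<iota> (V \<odot> W)" "\<iota> b" db]
      interchange3[of "\<iota> c" "\<iota> c" "dc \<otimes> \<iota> (U \<odot> V \<odot> W \<odot> b)" "shuffle (c \<odot> c) U (V \<odot> W) b" db "\<iota> (b \<odot> b)"]
    by (simp add: in_hom)
  have r3: "(\<iota> c \<otimes> (dc \<otimes> \<iota> (U \<odot> V \<odot> W \<odot> b)) \<otimes> db) \<cdot> (dc \<otimes> \<iota> (U \<odot> V \<odot> W) \<otimes> db) = ?dr"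
    using interchange3[of dc "\<iota> c \<otimes> dc" "\<iota> (U \<odot> V \<odot> W)" "\<iota> (U \<odot> V \<odot> W)" db "\<iota> b \<otimes> db"] by simp
  have "?r = ?XYZ \<cdot> ?sr \<cdot> ((\<iota> c \<otimes> (\<iota> (U \<odot> b) \<otimes> dc \<otimes> \<iota> (V \<odot> W)) \<otimes> db) \<cdot> (\<iota> c \<otimes> shuffle c U (V \<odot> W) b \<otimes> \<iota> b))
     \<cdot> (dc \<otimes> \<iota> (U \<odot> V \<odot> W) \<otimes> db)"
    unfolding conv_def[of _ _ U "V \<odot> W"] r1 by simp
  also have "\<dots> = ?XYZ \<cdot> (?sr \<cdot> ?sr') \<cdot> ?dr"
    unfolding r2 r3[symmetric] by simp
  finally have r: "?r = ?XYZ \<cdot> (?sr \<cdot> ?sr') \<cdot> ?dr" .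
  have "?sl \<cdot> ?sl' = ?sr \<cdot> ?sr'"
    using whisker_eq[OF shuffle_assoc[of c c U V W b b], of c b] by simp
  then show ?thesis
    unfolding l r dc db by (rule arg_cong)
qed

text \<open>
  The outer shuffle passes \<open>X' \<otimes> Y'\<close> by naturality, so that it is applied to the strands
  \<open>c', V, b'\<close> and \<open>c', W, b'\<close>. What remains is the braid identity \<open>shuffle_comp\<close>, in which the
  crossings of \<open>c\<close> with \<open>c'\<close> and of \<open>b'\<close> with \<open>b\<close> are those in the comultiplications of \<open>c \<otimes> c'\<close> and
  \<open>b' \<otimes> b\<close>.
\<close>

lemma conv_comp:
  assumes "dc \<in> hom M c (c \<odot> c)" "db \<in> hom M b (b \<odot> b)"
    "dc' \<in> hom M c' (c' \<odot> c')" "db' \<in> hom M b' (b' \<odot> b')"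
    "X \<in> hom M (c \<odot> V' \<odot> b) V''" "Y \<in> hom M (c \<odot> W' \<odot> b) W''"
    "X' \<in> hom M (c' \<odot> V \<odot> b') V'" "Y' \<in> hom M (c' \<odot> W \<odot> b') W'"
    "V \<in> Obj M" "W \<in> Obj M"
  shows "conv dc db V' W' X Y \<cdot> (\<iota> c \<otimes> conv dc' db' V W X' Y' \<otimes> \<iota> b)
    = conv ((\<iota> c \<otimes> \<Psi> c c' \<otimes> \<iota> c') \<cdot> (dc \<otimes> dc')) ((\<iota> b' \<otimes> \<Psi> b' b \<otimes> \<iota> b) \<cdot> (db' \<otimes> db)) V W
      (X \<cdot> (\<iota> c \<otimes> X' \<otimes> \<iota> b)) (Y \<cdot> (\<iota> c \<otimes> Y' \<otimes> \<iota> b))"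
    (is "?l = ?r")
proof -
  note [simp] = assms[unfolded in_hom] assms(1-8)[THEN hom_Obj]
  note [simp] = conv_hom[unfolded in_hom, of _ c' _ b']
  let ?S = "shuffle c' V W b'"
  let ?XY' = "X' \<otimes> Y'"
  let ?XY = "(X \<cdot> (\<iota> c \<otimes> X' \<otimes> \<iota> b)) \<otimes> (Y \<cdot> (\<iota> c \<otimes> Y' \<otimes> \<iota> b))"
  let ?sl = "\<iota> c \<otimes> shuffle c (c' \<odot> V \<odot> b') (c' \<odot> W \<odot> b') b \<otimes> \<iota> b"
  let ?sl' = "\<iota> (c \<odot> c \<odot> c') \<otimes> ?S \<otimes> \<iota> (b' \<odot> b \<odot> b)"
  let ?sr = "\<iota> (c \<odot> c') \<otimes> shuffle (c \<odot> c') V W (b' \<odot> b) \<otimes> \<iota> (b' \<odot> b)"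
  let ?sr' = "\<iota> c \<otimes> \<Psi> c c' \<otimes> \<iota> (c' \<odot> V \<odot> W \<odot> b') \<otimes> \<Psi> b' b \<otimes> \<iota> b"
  let ?d = "dc \<otimes> dc' \<otimes> \<iota> (V \<odot> W) \<otimes> db' \<otimes> db"
  have l1: "(dc \<otimes> \<iota> (V' \<odot> W') \<otimes> db) \<cdot> (\<iota> c \<otimes> conv dc' db' V W X' Y' \<otimes> \<iota> b)
     = (\<iota> c \<otimes> (\<iota> c \<otimes> X' \<otimes> Y' \<otimes> \<iota> b) \<otimes> \<iota> b) \<cdot> ?sl' \<cdot> ?d"
  proof -
    have "(dc \<otimes> \<iota> (V' \<odot> W') \<otimes> db) \<cdot> (\<iota> c \<otimes> conv dc' db' V W X' Y' \<otimes> \<iota> b)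
      = dc \<otimes> conv dc' db' V W X' Y' \<otimes> db"
      using interchange3[of "\<iota> c" dc "conv dc' db' V W X' Y'" "\<iota> (V' \<odot> W')" "\<iota> b" db] by simp
    also have "\<dots> = (\<iota> (c \<odot> c) \<otimes> ?XY' \<otimes> \<iota> (b \<odot> b))
       \<cdot> (dc \<otimes> ((\<iota> c' \<otimes> ?S \<otimes> \<iota> b') \<cdot> (dc' \<otimes> \<iota> (V \<odot> W) \<otimes> db')) \<otimes> db)"
      using interchange3[of dc "\<iota> (c \<odot> c)" "(\<iota> c' \<otimes> ?S \<otimes> \<iota> b') \<cdot> (dc' \<otimes> \<iota> (V \<odot> W) \<otimes> db')" ?XY' db "\<iota> (b \<odot> b)"]
      by (simp add: conv_def)
    also have "\<dots> = (\<iota> (c \<odot> c) \<otimes> ?XY' \<otimes> \<iota> (b \<odot> b)) \<cdot> ?sl' \<cdot> ?d"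
      using interchange3[of dc "\<iota> (c \<odot> c)" "dc' \<otimes> \<iota> (V \<odot> W) \<otimes> db'" "\<iota> c' \<otimes> ?S \<otimes> \<iota> b'" db "\<iota> (b \<odot> b)"]
      by simp
    finally show ?thesis by simp
  qed
  have l2: "(\<iota> c \<otimes> shuffle c V' W' b \<otimes> \<iota> b) \<cdot> (\<iota> c \<otimes> (\<iota> c \<otimes> X' \<otimes> Y' \<otimes> \<iota> b) \<otimes> \<iota> b)
    = ((\<iota> c \<otimes> X' \<otimes> \<iota> b) \<otimes> (\<iota> c \<otimes> Y' \<otimes> \<iota> b)) \<cdot> ?sl"
    using whisker_eq[OF shuffle_natural[of "\<iota> c" c c X' "c' \<odot> V \<odot> b'" V' Y' "c' \<odot> W \<odot> b'" W' "\<iota> b" b b], of c b]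
    by (simp add: in_hom)
  have s: "?sl \<cdot> ?sl' = ?sr \<cdot> ?sr'"
    using whisker_eq[OF shuffle_comp[of c c' c' V W b' b' b], of c b] by simp
  have r1: "?sr' \<cdot> ?d
      = ((\<iota> c \<otimes> \<Psi> c c' \<otimes> \<iota> c') \<cdot> (dc \<otimes> dc')) \<otimes> \<iota> (V \<odot> W) \<otimes> ((\<iota> b' \<otimes> \<Psi> b' b \<otimes> \<iota> b) \<cdot> (db' \<otimes> db))"
    using interchange3[of "dc \<otimes> dc'" "\<iota> c \<otimes> \<Psi> c c' \<otimes> \<iota> c'" "\<iota> (V \<odot> W)" "\<iota> (V \<odot> W)"
      "db' \<otimes> db" "\<iota> b' \<otimes> \<Psi> b' b \<otimes> \<iota> b"] by simp
  have "?l = (X \<otimes> Y) \<cdot> (\<iota> c \<otimes> shuffle c V' W' b \<otimes> \<iota> b)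
     \<cdot> ((dc \<otimes> \<iota> (V' \<odot> W') \<otimes> db) \<cdot> (\<iota> c \<otimes> conv dc' db' V W X' Y' \<otimes> \<iota> b))"
    by (simp add: conv_def[of dc])
  also have "\<dots> = (X \<otimes> Y) \<cdot> ((\<iota> c \<otimes> shuffle c V' W' b \<otimes> \<iota> b) \<cdot> (\<iota> c \<otimes> (\<iota> c \<otimes> X' \<otimes> Y' \<otimes> \<iota> b) \<otimes> \<iota> b))
     \<cdot> ?sl' \<cdot> ?d"
    unfolding l1 by simp
  also have "\<dots> = ((X \<otimes> Y) \<cdot> ((\<iota> c \<otimes> X' \<otimes> \<iota> b) \<otimes> (\<iota> c \<otimes> Y' \<otimes> \<iota> b))) \<cdot> (?sl \<cdot> ?sl') \<cdot> ?d"
    unfolding l2 by simp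
  also have "\<dots> = ?XY \<cdot> ?sr \<cdot> (?sr' \<cdot> ?d)"
    unfolding s by (subst interchange) simp_all
  also have "\<dots> = ?r"
    unfolding r1 conv_def by simp
  finally show ?thesis .
qed

text \<open>
  A counit, being a map to the unit object, can be pulled through the braiding without a trace; it
  then cancels the comultiplication.
\<close>

lemma conv_unit_left:
  assumes "dc \<in> hom M c (c \<odot> c)" "db \<in> hom M b (b \<odot> b)" "e \<in> hom M c \<I>" "e' \<in> hom M b \<I>"
    "Y \<in> hom M (c \<odot> V \<odot> b) V'" "V \<in> Obj M"
   and dc: "(e \<otimes> \<iota> c) \<cdot> dc = \<iota> c" and db: "(e' \<otimes> \<iota> b) \<cdot> db = \<iota> b"
  shows "conv dc db \<I> V (e \<otimes> e') Y = Y"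
proof -
  note [simp] = assms[unfolded in_hom] assms(1-2)[THEN hom_Obj]
  have 1: "(e' \<otimes> \<iota> (c \<odot> V)) \<cdot> \<Psi> (c \<odot> V) b = \<iota> (c \<odot> V) \<otimes> e'"
    using natural[of "\<iota> (c \<odot> V)" e'] by simp
  have "conv dc db \<I> V (e \<otimes> e') Y = (Y \<cdot> (e \<otimes> (e' \<otimes> \<iota> (c \<odot> V)) \<otimes> \<iota> b))
     \<cdot> (\<iota> c \<otimes> \<Psi> (c \<odot> V) b \<otimes> \<iota> b) \<cdot> (dc \<otimes> \<iota> V \<otimes> db)"
    using interchange[of "e \<otimes> e'" "\<iota> \<I>" "\<iota> (c \<odot> V \<odot> b)" Y]
    by (simp add: conv_def shuffle_def)
  also have "\<dots> = Y \<cdot> ((e \<otimes> (e' \<otimes> \<iota> (c \<odot> V)) \<otimes> \<iota> b) \<cdot> (\<iota> c \<otimes> \<Psi> (c \<odot> V) b \<otimes> \<iota> b)) \<cdot> (dc \<otimes> \<iota> V \<otimes> db)"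
    by simp
  also have "\<dots> = Y \<cdot> (e \<otimes> ((e' \<otimes> \<iota> (c \<odot> V)) \<cdot> \<Psi> (c \<odot> V) b) \<otimes> \<iota> b) \<cdot> (dc \<otimes> \<iota> V \<otimes> db)"
    by (subst interchange3) simp_all
  also have "\<dots> = Y \<cdot> ((e \<otimes> \<iota> c) \<otimes> \<iota> V \<otimes> (e' \<otimes> \<iota> b)) \<cdot> (dc \<otimes> \<iota> V \<otimes> db)"
    unfolding 1 by simp
  also have "\<dots> = Y"
    by (subst interchange3) (simp_all add: dc db)
  finally show ?thesis .
qed

lemma conv_unit_right:
  assumes "dc \<in> hom M c (c \<odot> c)" "db \<in> hom M b (b \<odot> b)" "e \<in> hom M c \<I>" "e' \<in> hom M b \<I>"
    "Y \<in> hom M (c \<odot> V \<odot> b) V'" "V \<in> Obj M"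
   and dc: "(\<iota> c \<otimes> e) \<cdot> dc = \<iota> c" and db: "(\<iota> b \<otimes> e') \<cdot> db = \<iota> b"
  shows "conv dc db V \<I> Y (e \<otimes> e') = Y"
proof -
  note [simp] = assms[unfolded in_hom] assms(1-2)[THEN hom_Obj]
  have 1: "(\<iota> (V \<odot> b) \<otimes> e) \<cdot> \<Psi> c (V \<odot> b) = e \<otimes> \<iota> (V \<odot> b)"
    using natural[of e "\<iota> (V \<odot> b)"] by simp
  have 2: "shuffle c V \<I> b = \<Psi> c (V \<odot> b)"
    by (simp add: shuffle_def Braid_TensorO_right)
  have "conv dc db V \<I> Y (e \<otimes> e') = (Y \<cdot> (\<iota> c \<otimes> (\<iota> (V \<odot> b) \<otimes> e) \<otimes> e'))
     \<cdot> (\<iota> c \<otimes> \<Psi> c (V \<odot> b) \<otimes> \<iota> b) \<cdot> (dc \<otimes> \<iota> V \<otimes> db)"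
    using interchange[of "\<iota> (c \<odot> V \<odot> b)" Y "e \<otimes> e'" "\<iota> \<I>"]
    by (simp add: conv_def 2)
  also have "\<dots> = Y \<cdot> ((\<iota> c \<otimes> (\<iota> (V \<odot> b) \<otimes> e) \<otimes> e') \<cdot> (\<iota> c \<otimes> \<Psi> c (V \<odot> b) \<otimes> \<iota> b)) \<cdot> (dc \<otimes> \<iota> V \<otimes> db)"
    by simp
  also have "\<dots> = Y \<cdot> (\<iota> c \<otimes> ((\<iota> (V \<odot> b) \<otimes> e) \<cdot> \<Psi> c (V \<odot> b)) \<otimes> e') \<cdot> (dc \<otimes> \<iota> V \<otimes> db)"
    by (subst interchange3) simp_all
  also have "\<dots> = Y \<cdot> ((\<iota> c \<otimes> e) \<otimes> \<iota> V \<otimes> (\<iota> b \<otimes> e')) \<cdot> (dc \<otimes> \<iota> V \<otimes> db)"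
    unfolding 1 by simp
  also have "\<dots> = Y"
    by (subst interchange3) (simp_all add: dc db)
  finally show ?thesis .
qed

lemma conv_trivial:
  assumes "X \<in> hom M V V'" "Y \<in> hom M W W'"
  shows "conv (\<iota> \<I>) (\<iota> \<I>) V W X Y = X \<otimes> Y"
proof -
  note [simp] = assms[unfolded in_hom] assms[THEN hom_Obj]
  show ?thesis by (simp add: conv_def shuffle_def)
qed

end

section \<open>Bimodules over a dual pairing\<close>

text \<open>
  The locale \<open>dually_paired_hopf_algebras\<close>, with the facts about the ambient category available
  without a qualifier.
\<close>

locale dual_pairing = braided_monoidal_category M + dually_paired_hopf_algebras M C B ev
  for M :: "('o, 'a, 'm) braided_category_scheme" (structure)
    and C B :: "('o, 'a) hopf" and ev :: 'a
begin

lemmas hopf_typing [simp] =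
  C.Ob_Obj C.mul_hom[unfolded in_hom] C.one_hom[unfolded in_hom] C.comul_hom[unfolded in_hom]
  C.counit_hom[unfolded in_hom]
  B.Ob_Obj B.mul_hom[unfolded in_hom] B.one_hom[unfolded in_hom] B.comul_hom[unfolded in_hom]
  B.counit_hom[unfolded in_hom] ev_hom[unfolded in_hom]

abbreviation "bimod \<equiv> is_bimod M C B"
abbreviation tensor (infixr "\<oslash>" 72) where "tensor \<equiv> bimod_tensor M C B"
abbreviation "conv\<^sub>C \<equiv> conv (comul C) (\<iota> \<I>)"
abbreviation "conv\<^sub>B \<equiv> conv (\<iota> \<I>) (comul B)"
abbreviation "conv\<^sub>C\<^sub>B \<equiv> conv (comul C) (comul B)"

text \<open>
  The maps \<open>N V\<close> and \<open>T V\<close> of the introduction: both compatibility conditions can be expressed by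
  them and the evaluation, and both are multiplicative in \<open>V\<close>.
\<close>

definition left_of_right :: "('o, 'a) bimod \<Rightarrow> 'a" where
  "left_of_right V = Lact V \<cdot> (\<iota> (Ob C) \<otimes> Ract V)"

definition right_of_left :: "('o, 'a) bimod \<Rightarrow> 'a" where
  "right_of_left V = Ract V \<cdot> (Lact V \<otimes> \<iota> (Ob B))"

lemma bimod_typing [simp]:
  assumes "bimod V"
  shows "Und V \<in> Obj M" "Lact V \<in> Arr M" "Dom M (Lact V) = Ob C \<odot> Und V" "Cod M (Lact V) = Und V"
    "Ract V \<in> Arr M" "Dom M (Ract V) = Und V \<odot> Ob B" "Cod M (Ract V) = Und V"
  using assms by (simp_all add: is_bimod_def in_hom)

lemma left_right_typing [simp]:
  assumes "bimod V"
  shows "left_of_right V \<in> Arr M" "Dom M (left_of_right V) = Ob C \<odot> Und V \<odot> Ob B" "Cod M (left_of_right V) = Und V"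
    "right_of_left V \<in> Arr M" "Dom M (right_of_left V) = Ob C \<odot> Und V \<odot> Ob B" "Cod M (right_of_left V) = Und V"
  using assms by (simp_all add: left_of_right_def right_of_left_def)

lemma Und_tensor [simp]: "Und (V \<oslash> W) = Und V \<odot> Und W"
  by (simp add: bimod_tensor_def)

lemma Lact_tensor:
  assumes [simp]: "bimod V" "bimod W"
  shows "Lact (V \<oslash> W) = conv\<^sub>C (Und V) (Und W) (Lact V) (Lact W)"
  by (simp add: bimod_tensor_def conv_def shuffle_def)

lemma Ract_tensor:
  assumes [simp]: "bimod V" "bimod W"
  shows "Ract (V \<oslash> W) = conv\<^sub>B (Und V) (Und W) (Ract V) (Ract W)"
  by (simp add: bimod_tensor_def conv_def shuffle_def)

lemma conv_actions_typing [simp]: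
  assumes [simp]: "bimod V" "bimod W"
  shows "conv\<^sub>C (Und V) (Und W) (Lact V) (Lact W) \<in> Arr M"
    "Dom M (conv\<^sub>C (Und V) (Und W) (Lact V) (Lact W)) = Ob C \<odot> Und V \<odot> Und W"
    "Cod M (conv\<^sub>C (Und V) (Und W) (Lact V) (Lact W)) = Und V \<odot> Und W"
    "conv\<^sub>B (Und V) (Und W) (Ract V) (Ract W) \<in> Arr M"
    "Dom M (conv\<^sub>B (Und V) (Und W) (Ract V) (Ract W)) = Und V \<odot> Und W \<odot> Ob B"
    "Cod M (conv\<^sub>B (Und V) (Und W) (Ract V) (Ract W)) = Und V \<odot> Und W"
  using conv_hom[of "comul C" "Ob C" "\<iota> \<I>" \<I> "Und V" "Und W" "Lact V" "Und V" "Lact W" "Und W"]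
   conv_hom[of "\<iota> \<I>" \<I> "comul B" "Ob B" "Und V" "Und W" "Ract V" "Und V" "Ract W" "Und W"]
  by (simp_all add: in_hom)

text \<open>
  The multiplication of \<open>C\<close> is a morphism of comultiplications from \<open>C \<otimes> C\<close> to \<open>C\<close>, so acting by a
  product is a convolution over \<open>C \<otimes> C\<close> by \<open>conv_pre\<close>. Acting twice is one by \<open>conv_comp\<close>, and the
  two agree factor by factor. Similarly, acting by the unit element is a convolution over the unit
  object, that is, a tensor product of arrows.
\<close>

lemma bimod_tensor_bimod:
  assumes V [simp]: "bimod V" and W [simp]: "bimod W"
  shows "bimod (V \<oslash> W)"
proof -
  have actC: "Lact X \<cdot> (mul C \<otimes> \<iota> (Und X)) = Lact X \<cdot> (\<iota> (Ob C) \<otimes> Lact X)"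
    "Lact X \<cdot> (one C \<otimes> \<iota> (Und X)) = \<iota> (Und X)" if "bimod X" for X
    using that by (simp_all add: is_bimod_def)
  have actB: "Ract X \<cdot> (\<iota> (Und X) \<otimes> mul B) = Ract X \<cdot> (Ract X \<otimes> \<iota> (Ob B))"
    "Ract X \<cdot> (\<iota> (Und X) \<otimes> one B) = \<iota> (Und X)" if "bimod X" for X
    using that by (simp_all add: is_bimod_def)
  let ?CC = "(\<iota> (Ob C) \<otimes> \<Psi> (Ob C) (Ob C) \<otimes> \<iota> (Ob C)) \<cdot> (comul C \<otimes> comul C)"
  let ?BB = "(\<iota> (Ob B) \<otimes> \<Psi> (Ob B) (Ob B) \<otimes> \<iota> (Ob B)) \<cdot> (comul B \<otimes> comul B)"
  have "Lact (V \<oslash> W) \<cdot> (mul C \<otimes> \<iota> (Und V \<odot> Und W))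
    = conv ?CC (\<iota> \<I>) (Und V) (Und W) (Lact V \<cdot> (mul C \<otimes> \<iota> (Und V))) (Lact W \<cdot> (mul C \<otimes> \<iota> (Und W)))"
    using conv_pre[of "comul C" "Ob C" "\<iota> \<I>" \<I> ?CC "Ob C \<odot> Ob C" "\<iota> \<I>" \<I> "Lact V" "Und V" "Und V"
       "Lact W" "Und W" "Und W" "\<iota> (Und V)" "Und V" "\<iota> (Und W)" "Und W" "mul C" "\<iota> \<I>"]
    by (simp add: in_hom Lact_tensor C.comul_mul)
  also have "\<dots> = Lact (V \<oslash> W) \<cdot> (\<iota> (Ob C) \<otimes> Lact (V \<oslash> W))"
    using conv_comp[of "comul C" "Ob C" "\<iota> \<I>" \<I> "comul C" "Ob C" "\<iota> \<I>" \<I> "Lact V" "Und V" "Und V"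
       "Lact W" "Und W" "Und W" "Lact V" "Und V" "Lact W" "Und W"]
    by (simp add: in_hom Lact_tensor actC)
  finally have 1: "Lact (V \<oslash> W) \<cdot> (mul C \<otimes> \<iota> (Und V \<odot> Und W)) = \<dots>" .
  have 2: "Lact (V \<oslash> W) \<cdot> (one C \<otimes> \<iota> (Und V \<odot> Und W)) = \<iota> (Und V \<odot> Und W)"
    using conv_pre[of "comul C" "Ob C" "\<iota> \<I>" \<I> "\<iota> \<I>" \<I> "\<iota> \<I>" \<I> "Lact V" "Und V" "Und V"
       "Lact W" "Und W" "Und W" "\<iota> (Und V)" "Und V" "\<iota> (Und W)" "Und W" "one C" "\<iota> \<I>"]
    by (simp add: in_hom Lact_tensor C.comul_one actC conv_trivial)
  have "Ract (V \<oslash> W) \<cdot> (\<iota> (Und V \<odot> Und W) \<otimes> mul B)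
    = conv (\<iota> \<I>) ?BB (Und V) (Und W) (Ract V \<cdot> (\<iota> (Und V) \<otimes> mul B)) (Ract W \<cdot> (\<iota> (Und W) \<otimes> mul B))"
    using conv_pre[of "\<iota> \<I>" \<I> "comul B" "Ob B" "\<iota> \<I>" \<I> ?BB "Ob B \<odot> Ob B" "Ract V" "Und V" "Und V"
       "Ract W" "Und W" "Und W" "\<iota> (Und V)" "Und V" "\<iota> (Und W)" "Und W" "\<iota> \<I>" "mul B"]
    by (simp add: in_hom Ract_tensor B.comul_mul)
  also have "\<dots> = Ract (V \<oslash> W) \<cdot> (Ract (V \<oslash> W) \<otimes> \<iota> (Ob B))"
    using conv_comp[of "\<iota> \<I>" \<I> "comul B" "Ob B" "\<iota> \<I>" \<I> "comul B" "Ob B" "Ract V" "Und V" "Und V"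
       "Ract W" "Und W" "Und W" "Ract V" "Und V" "Ract W" "Und W"]
    by (simp add: in_hom Ract_tensor actB)
  finally have 3: "Ract (V \<oslash> W) \<cdot> (\<iota> (Und V \<odot> Und W) \<otimes> mul B) = \<dots>" .
  have 4: "Ract (V \<oslash> W) \<cdot> (\<iota> (Und V \<odot> Und W) \<otimes> one B) = \<iota> (Und V \<odot> Und W)"
    using conv_pre[of "\<iota> \<I>" \<I> "comul B" "Ob B" "\<iota> \<I>" \<I> "\<iota> \<I>" \<I> "Ract V" "Und V" "Und V"
       "Ract W" "Und W" "Und W" "\<iota> (Und V)" "Und V" "\<iota> (Und W)" "Und W" "\<iota> \<I>" "one B"]
    by (simp add: in_hom Ract_tensor B.comul_one actB conv_trivial)
  show ?thesis
    unfolding is_bimod_def using 1 2 3 4 by (simp add: in_hom Lact_tensor Ract_tensor)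
qed

text \<open>
  When one of the two actions in \<open>conv_comp\<close> involves only \<open>C\<close> and the other one only \<open>B\<close>, the
  additional crossings of that lemma involve the unit object and vanish.
\<close>

lemma left_of_right_tensor:
  assumes [simp]: "bimod V" "bimod W"
  shows "left_of_right (V \<oslash> W) = conv\<^sub>C\<^sub>B (Und V) (Und W) (left_of_right V) (left_of_right W)"
  using conv_comp[of "comul C" "Ob C" "\<iota> \<I>" \<I> "\<iota> \<I>" \<I> "comul B" "Ob B" "Lact V" "Und V" "Und V"
       "Lact W" "Und W" "Und W" "Ract V" "Und V" "Ract W" "Und W"]
  by (simp add: left_of_right_def in_hom Lact_tensor Ract_tensor)

lemma right_of_left_tensor:
  assumes [simp]: "bimod V" "bimod W"
  shows "right_of_left (V \<oslash> W) = conv\<^sub>C\<^sub>B (Und V) (Und W) (right_of_left V) (right_of_left W)"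
  using conv_comp[of "\<iota> \<I>" \<I> "comul B" "Ob B" "comul C" "Ob C" "\<iota> \<I>" \<I> "Ract V" "Und V" "Und V"
       "Ract W" "Und W" "Und W" "Lact V" "Und V" "Lact W" "Und W"]
  by (simp add: right_of_left_def in_hom Lact_tensor Ract_tensor)

text \<open>
  The two sides of the compatibility conditions are convolutions with the evaluation, viewed as a map
  \<open>C \<otimes> I \<otimes> B \<rightarrow> I\<close>. In the conditions the action is applied before the braiding, in the convolution
  afterwards; the braiding is natural.
\<close>

lemma ev_conv_right_of_left:
  assumes [simp]: "bimod V"
  shows "(ev \<otimes> Ract V) \<cdot> (\<iota> (Ob C) \<otimes> \<Psi> (Und V) (Ob B) \<otimes> \<iota> (Ob B))
      \<cdot> (\<iota> (Ob C) \<otimes> Lact V \<otimes> \<iota> (Ob B \<odot> Ob B)) \<cdot> (comul C \<otimes> \<iota> (Und V) \<otimes> comul B)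
    = conv\<^sub>C\<^sub>B \<I> (Und V) ev (right_of_left V)" (is "_ = ?r")
proof -
  have 1: "(\<iota> (Ob C) \<otimes> \<Psi> (Und V) (Ob B) \<otimes> \<iota> (Ob B)) \<cdot> (\<iota> (Ob C) \<otimes> Lact V \<otimes> \<iota> (Ob B \<odot> Ob B))
     = (\<iota> (Ob C \<odot> Ob B) \<otimes> Lact V \<otimes> \<iota> (Ob B)) \<cdot> (\<iota> (Ob C) \<otimes> \<Psi> (Ob C \<odot> Und V) (Ob B) \<otimes> \<iota> (Ob B))"
    using whisker_eq[OF natural[of "Lact V" "\<iota> (Ob B)"], of "Ob C" "Ob B"] by simp
  have 2: "ev \<otimes> right_of_left V = (ev \<otimes> Ract V) \<cdot> (\<iota> (Ob C \<odot> Ob B) \<otimes> Lact V \<otimes> \<iota> (Ob B))"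
    using interchange[of "\<iota> (Ob C \<odot> Ob B)" ev "Lact V \<otimes> \<iota> (Ob B)" "Ract V"] by (simp add: right_of_left_def)
  have "?r = (ev \<otimes> Ract V) \<cdot> ((\<iota> (Ob C \<odot> Ob B) \<otimes> Lact V \<otimes> \<iota> (Ob B))
      \<cdot> (\<iota> (Ob C) \<otimes> \<Psi> (Ob C \<odot> Und V) (Ob B) \<otimes> \<iota> (Ob B))) \<cdot> (comul C \<otimes> \<iota> (Und V) \<otimes> comul B)"
    by (simp add: conv_def shuffle_def 2)
  then show ?thesis unfolding 1[symmetric] by simp
qed

lemma left_of_right_conv_ev:
  assumes [simp]: "bimod V"
  shows "(Lact V \<otimes> ev) \<cdot> (\<iota> (Ob C) \<otimes> \<Psi> (Ob C) (Und V) \<otimes> \<iota> (Ob B))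
      \<cdot> (\<iota> (Ob C \<odot> Ob C) \<otimes> Ract V \<otimes> \<iota> (Ob B)) \<cdot> (comul C \<otimes> \<iota> (Und V) \<otimes> comul B)
    = conv\<^sub>C\<^sub>B (Und V) \<I> (left_of_right V) ev" (is "_ = ?r")
proof -
  have 1: "(\<iota> (Ob C) \<otimes> \<Psi> (Ob C) (Und V) \<otimes> \<iota> (Ob B)) \<cdot> (\<iota> (Ob C \<odot> Ob C) \<otimes> Ract V \<otimes> \<iota> (Ob B))
     = (\<iota> (Ob C) \<otimes> Ract V \<otimes> \<iota> (Ob C \<odot> Ob B)) \<cdot> (\<iota> (Ob C) \<otimes> \<Psi> (Ob C) (Und V \<odot> Ob B) \<otimes> \<iota> (Ob B))"
    using whisker_eq[OF natural[of "\<iota> (Ob C)" "Ract V"], of "Ob C" "Ob B"] by simp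
  have 2: "shuffle (Ob C) (Und V) \<I> (Ob B) = \<Psi> (Ob C) (Und V \<odot> Ob B)"
    by (simp add: shuffle_def Braid_TensorO_right)
  have 3: "left_of_right V \<otimes> ev = (Lact V \<otimes> ev) \<cdot> (\<iota> (Ob C) \<otimes> Ract V \<otimes> \<iota> (Ob C \<odot> Ob B))"
    using interchange[of "\<iota> (Ob C) \<otimes> Ract V" "Lact V" "\<iota> (Ob C \<odot> Ob B)" ev] by (simp add: left_of_right_def)
  have "?r = (Lact V \<otimes> ev) \<cdot> ((\<iota> (Ob C) \<otimes> Ract V \<otimes> \<iota> (Ob C \<odot> Ob B))
      \<cdot> (\<iota> (Ob C) \<otimes> \<Psi> (Ob C) (Und V \<odot> Ob B) \<otimes> \<iota> (Ob B))) \<cdot> (comul C \<otimes> \<iota> (Und V) \<otimes> comul B)"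
    by (simp add: conv_def 2 3)
  then show ?thesis unfolding 1[symmetric] by simp
qed

lemma yd_iff:
  "bimod V \<Longrightarrow> yd_condition M C B ev V \<longleftrightarrow> conv\<^sub>C\<^sub>B \<I> (Und V) ev (right_of_left V) = conv\<^sub>C\<^sub>B (Und V) \<I> (left_of_right V) ev"
  unfolding yd_condition_def by (simp only: ev_conv_right_of_left left_of_right_conv_ev)

lemma h_iff:
  "bimod V \<Longrightarrow> h_condition M C B ev V \<longleftrightarrow> left_of_right V = conv\<^sub>C\<^sub>B \<I> (Und V) ev (right_of_left V)"
  unfolding h_condition_def by (simp only: ev_conv_right_of_left flip: left_of_right_def)

lemma CB_assoc:
  assumes "X \<in> hom M (Ob C \<odot> U \<odot> Ob B) U'" "Y \<in> hom M (Ob C \<odot> V \<odot> Ob B) V'"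
    "Z \<in> hom M (Ob C \<odot> W \<odot> Ob B) W'" "U \<in> Obj M" "V \<in> Obj M" "W \<in> Obj M"
  shows "conv\<^sub>C\<^sub>B (U \<odot> V) W (conv\<^sub>C\<^sub>B U V X Y) Z = conv\<^sub>C\<^sub>B U (V \<odot> W) X (conv\<^sub>C\<^sub>B V W Y Z)"
  by (rule conv_assoc[OF C.comul_hom B.comul_hom assms C.comul_coassoc B.comul_coassoc])

text \<open>
  Writing \<open>N\<close> for \<open>left_of_right\<close> and \<open>T\<close> for \<open>right_of_left\<close>, associativity of \<open>conv\<close> gives
  \<open>ev * T V * T W = N V * ev * T W = N V * N W * ev\<close>.
\<close>

lemma yd_tensor:
  assumes V [simp]: "bimod V" and W [simp]: "bimod W"
    and "yd_condition M C B ev V" "yd_condition M C B ev W"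
  shows "yd_condition M C B ev (V \<oslash> W)"
proof -
  let ?V = "Und V" and ?W = "Und W"
  have V': "conv\<^sub>C\<^sub>B \<I> ?V ev (right_of_left V) = conv\<^sub>C\<^sub>B ?V \<I> (left_of_right V) ev"
    and W': "conv\<^sub>C\<^sub>B \<I> ?W ev (right_of_left W) = conv\<^sub>C\<^sub>B ?W \<I> (left_of_right W) ev"
    using assms(3,4) by (simp_all add: yd_iff)
  have "conv\<^sub>C\<^sub>B \<I> (?V \<odot> ?W) ev (right_of_left (V \<oslash> W)) = conv\<^sub>C\<^sub>B ?V ?W (conv\<^sub>C\<^sub>B \<I> ?V ev (right_of_left V)) (right_of_left W)"
    using CB_assoc[of ev \<I> \<I> "right_of_left V" ?V ?V "right_of_left W" ?W ?W] by (simp add: in_hom right_of_left_tensor)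
  also have "\<dots> = conv\<^sub>C\<^sub>B ?V ?W (left_of_right V) (conv\<^sub>C\<^sub>B ?W \<I> (left_of_right W) ev)"
    using CB_assoc[of "left_of_right V" ?V ?V ev \<I> \<I> "right_of_left W" ?W ?W] by (simp add: in_hom V' W')
  also have "\<dots> = conv\<^sub>C\<^sub>B (?V \<odot> ?W) \<I> (left_of_right (V \<oslash> W)) ev"
    using CB_assoc[of "left_of_right V" ?V ?V "left_of_right W" ?W ?W ev \<I> \<I>] by (simp add: in_hom left_of_right_tensor)
  finally show ?thesis by (simp add: yd_iff bimod_tensor_bimod)
qed

text \<open>
  As before, \<open>N V * N W = N V * ev * T W = ev * T V * T W\<close>.
\<close>

lemma h_tensor:
  assumes V [simp]: "bimod V" and W [simp]: "bimod W"
    and "yd_condition M C B ev V" "h_condition M C B ev W"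
  shows "h_condition M C B ev (V \<oslash> W)"
proof -
  let ?V = "Und V" and ?W = "Und W"
  have V': "conv\<^sub>C\<^sub>B \<I> ?V ev (right_of_left V) = conv\<^sub>C\<^sub>B ?V \<I> (left_of_right V) ev"
    and W': "left_of_right W = conv\<^sub>C\<^sub>B \<I> ?W ev (right_of_left W)"
    using assms(3,4) by (simp_all only: yd_iff[OF V] h_iff[OF W])
  have "left_of_right (V \<oslash> W) = conv\<^sub>C\<^sub>B ?V ?W (left_of_right V) (conv\<^sub>C\<^sub>B \<I> ?W ev (right_of_left W))"
    unfolding left_of_right_tensor[OF V W] W'[symmetric] ..
  also have "\<dots> = conv\<^sub>C\<^sub>B ?V ?W (conv\<^sub>C\<^sub>B \<I> ?V ev (right_of_left V)) (right_of_left W)"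
    using CB_assoc[of "left_of_right V" ?V ?V ev \<I> \<I> "right_of_left W" ?W ?W] by (simp add: in_hom V')
  also have "\<dots> = conv\<^sub>C\<^sub>B \<I> (?V \<odot> ?W) ev (right_of_left (V \<oslash> W))"
    using CB_assoc[of ev \<I> \<I> "right_of_left V" ?V ?V "right_of_left W" ?W ?W] by (simp add: in_hom right_of_left_tensor)
  finally show ?thesis by (simp add: h_iff bimod_tensor_bimod)
qed

abbreviation unit_bimod ("\<one>") where "\<one> \<equiv> bimod_unit M C B"

lemma unit_bimod_simps [simp]: "Und \<one> = \<I>" "Lact \<one> = counit C" "Ract \<one> = counit B"
  by (simp_all add: bimod_unit_def)

lemma bimod_unit: "bimod \<one>"
  using interchange[of "\<iota> (Ob C)" "counit C" "counit C" "\<iota> \<I>"] interchange[of "counit B" "\<iota> \<I>" "\<iota> (Ob B)" "counit B"]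
  unfolding is_bimod_def by (simp add: in_hom C.counit_mul C.counit_one B.counit_mul B.counit_one)

lemma left_right_unit: "left_of_right \<one> = counit C \<otimes> counit B" "right_of_left \<one> = counit C \<otimes> counit B"
  using interchange[of "\<iota> (Ob C)" "counit C" "counit B" "\<iota> \<I>"] interchange[of "counit C" "\<iota> \<I>" "\<iota> (Ob B)" "counit B"]
  by (simp_all add: left_of_right_def right_of_left_def)

text \<open>
  On the unit object both composites of the actions are the counits, which are neutral for \<open>conv\<close>. So
  both sides of the condition are \<open>ev\<close>.
\<close>

lemma yd_unit: "yd_condition M C B ev \<one>"
  using conv_unit_left[of "comul C" "Ob C" "comul B" "Ob B" "counit C" "counit B" ev \<I> \<I>]
    conv_unit_right[of "comul C" "Ob C" "comul B" "Ob B" "counit C" "counit B" ev \<I> \<I>]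
  by (simp add: yd_iff bimod_unit left_right_unit in_hom C.comul_counit_left
    B.comul_counit_left C.comul_counit_right B.comul_counit_right)

lemma bimod_eqI: "Und V = Und W \<Longrightarrow> Lact V = Lact W \<Longrightarrow> Ract V = Ract W \<Longrightarrow> V = W"
  for V W :: "('o, 'a) bimod"
  by (rule bimod.equality) simp_all

text \<open>
  Equality on the nose: the underlying objects agree by strictness, and the actions by
  associativity of \<open>conv\<close>.
\<close>

lemma tensor_assoc:
  assumes [simp]: "bimod U" "bimod V" "bimod W"
  shows "(U \<oslash> V) \<oslash> W = U \<oslash> V \<oslash> W"
  using conv_assoc[of "comul C" "Ob C" "\<iota> \<I>" \<I> "Lact U" "Und U" "Und U" "Lact V" "Und V" "Und V" "Lact W" "Und W" "Und W"]
  conv_assoc[of "\<iota> \<I>" \<I> "comul B" "Ob B" "Ract U" "Und U" "Und U" "Ract V" "Und V" "Und V" "Ract W" "Und W" "Und W"]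
  by (intro bimod_eqI) (simp_all add: bimod_tensor_bimod Lact_tensor Ract_tensor in_hom C.comul_coassoc B.comul_coassoc)

lemma tensor_unit:
  assumes [simp]: "bimod V"
  shows "\<one> \<oslash> V = V" "V \<oslash> \<one> = V"
  using conv_unit_left[of "comul C" "Ob C" "\<iota> \<I>" \<I> "counit C" "\<iota> \<I>" "Lact V" "Und V" "Und V"]
    conv_unit_left[of "\<iota> \<I>" \<I> "comul B" "Ob B" "\<iota> \<I>" "counit B" "Ract V" "Und V" "Und V"]
    conv_unit_right[of "comul C" "Ob C" "\<iota> \<I>" \<I> "counit C" "\<iota> \<I>" "Lact V" "Und V" "Und V"]
    conv_unit_right[of "\<iota> \<I>" \<I> "comul B" "Ob B" "\<iota> \<I>" "counit B" "Ract V" "Und V" "Und V"]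
  by (auto intro!: bimod_eqI simp: Lact_tensor Ract_tensor bimod_unit in_hom C.comul_counit_left
    B.comul_counit_left C.comul_counit_right B.comul_counit_right)

lemma tensor_map_equivariant:
  assumes [simp]: "bimod V" "bimod V'" "bimod W" "bimod W'"
    "f \<in> Arr M" "Dom M f = Und V" "Cod M f = Und V'" "g \<in> Arr M" "Dom M g = Und W" "Cod M g = Und W'"
  and f: "f \<cdot> Lact V = Lact V' \<cdot> (\<iota> (Ob C) \<otimes> f)" "f \<cdot> Ract V = Ract V' \<cdot> (f \<otimes> \<iota> (Ob B))"
  and g: "g \<cdot> Lact W = Lact W' \<cdot> (\<iota> (Ob C) \<otimes> g)" "g \<cdot> Ract W = Ract W' \<cdot> (g \<otimes> \<iota> (Ob B))"
  shows "(f \<otimes> g) \<cdot> Lact (V \<oslash> W) = Lact (V' \<oslash> W') \<cdot> (\<iota> (Ob C) \<otimes> f \<otimes> g)"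
    "(f \<otimes> g) \<cdot> Ract (V \<oslash> W) = Ract (V' \<oslash> W') \<cdot> ((f \<otimes> g) \<otimes> \<iota> (Ob B))"
  using conv_post[of "comul C" "Ob C" "\<iota> \<I>" \<I> "Und V" "Und W" "Lact V" "Und V" "Lact W" "Und W" f "Und V'" g "Und W'"]
    conv_pre[of "comul C" "Ob C" "\<iota> \<I>" \<I> "comul C" "Ob C" "\<iota> \<I>" \<I> "Lact V'" "Und V'" "Und V'" "Lact W'" "Und W'" "Und W'"
      f "Und V" g "Und W" "\<iota> (Ob C)" "\<iota> \<I>"]
    conv_post[of "\<iota> \<I>" \<I> "comul B" "Ob B" "Und V" "Und W" "Ract V" "Und V" "Ract W" "Und W" f "Und V'" g "Und W'"]
    conv_pre[of "\<iota> \<I>" \<I> "comul B" "Ob B" "\<iota> \<I>" \<I> "comul B" "Ob B" "Ract V'" "Und V'" "Und V'" "Ract W'" "Und W'" "Und W'"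
      f "Und V" g "Und W" "\<iota> \<I>" "\<iota> (Ob B)"]
  by (simp_all add: Lact_tensor Ract_tensor in_hom f g)

section \<open>The categories and the action\<close>

abbreviation "arrows \<equiv> bimod_arrows M C B"

lemma tensor_arrow:
  assumes "\<phi> \<in> arrows \<O>" "\<psi> \<in> arrows \<P>" "\<O> \<subseteq> Collect bimod" "\<P> \<subseteq> Collect bimod"
    and "\<And>V W. V \<in> \<O> \<Longrightarrow> W \<in> \<P> \<Longrightarrow> V \<oslash> W \<in> \<Q>"
  shows "bimod_tensor_arrow M C B \<phi> \<psi> \<in> arrows \<Q>"
proof -
  have b: "bimod (Src \<phi>)" "bimod (Tgt \<phi>)" "bimod (Src \<psi>)" "bimod (Tgt \<psi>)"
    using assms(1-4) by (auto simp: bimod_arrows_def)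
  have "(Map \<phi> \<otimes> Map \<psi>) \<cdot> Lact (Src \<phi> \<oslash> Src \<psi>) = Lact (Tgt \<phi> \<oslash> Tgt \<psi>) \<cdot> (\<iota> (Ob C) \<otimes> Map \<phi> \<otimes> Map \<psi>)"
    "(Map \<phi> \<otimes> Map \<psi>) \<cdot> Ract (Src \<phi> \<oslash> Src \<psi>) = Ract (Tgt \<phi> \<oslash> Tgt \<psi>) \<cdot> ((Map \<phi> \<otimes> Map \<psi>) \<otimes> \<iota> (Ob B))"
    by (rule tensor_map_equivariant[OF b]; use assms(1,2) in \<open>simp add: bimod_arrows_def in_hom\<close>)+
  then show ?thesis
    using assms by (auto simp: bimod_arrows_def bimod_tensor_arrow_def in_hom)
qed

lemma ident_arrow:
  assumes "V \<in> \<O>" "\<O> \<subseteq> Collect bimod"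
  shows "bimod_ident M V \<in> arrows \<O>"
proof -
  have [simp]: "bimod V" using assms by auto
  show ?thesis using assms by (simp add: bimod_arrows_def bimod_ident_def in_hom)
qed

lemma comp_arrow:
  assumes "\<phi> \<in> arrows \<O>" "\<psi> \<in> arrows \<O>" "Tgt \<phi> = Src \<psi>" "\<O> \<subseteq> Collect bimod"
  shows "bimod_comp M \<psi> \<phi> \<in> arrows \<O>"
proof -
  obtain V f W where \<phi>: "\<phi> = \<lparr>Src = V, Map = f, Tgt = W\<rparr>" by (cases \<phi>)
  obtain g X where \<psi>: "\<psi> = \<lparr>Src = W, Map = g, Tgt = X\<rparr>" using assms(3) \<phi> by (cases \<psi>) auto
  have [simp]: "bimod V" "bimod W" "bimod X"
    and fg [simp]: "f \<in> Arr M" "Dom M f = Und V" "Cod M f = Und W" "g \<in> Arr M" "Dom M g = Und W" "Cod M g = Und X"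
    and f: "f \<cdot> Lact V = Lact W \<cdot> (\<iota> (Ob C) \<otimes> f)" "f \<cdot> Ract V = Ract W \<cdot> (f \<otimes> \<iota> (Ob B))"
    and g: "g \<cdot> Lact W = Lact X \<cdot> (\<iota> (Ob C) \<otimes> g)" "g \<cdot> Ract W = Ract X \<cdot> (g \<otimes> \<iota> (Ob B))"
    using assms(1,2,4) \<phi> \<psi> by (auto simp: bimod_arrows_def in_hom)
  have "(g \<cdot> f) \<cdot> Lact V = Lact X \<cdot> (\<iota> (Ob C) \<otimes> (g \<cdot> f))"
    using Comp_eq_tail[OF g(1), of "\<iota> (Ob C) \<otimes> f"] by (simp add: f layers)
  moreover have "(g \<cdot> f) \<cdot> Ract V = Ract X \<cdot> ((g \<cdot> f) \<otimes> \<iota> (Ob B))"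
    using Comp_eq_tail[OF g(2), of "f \<otimes> \<iota> (Ob B)"] by (simp add: f layers)
  ultimately show ?thesis
    using assms(1,2) by (simp add: \<phi> \<psi> bimod_arrows_def bimod_comp_def in_hom)
qed

text \<open>
  Stated for any class of bimodules, as the two categories differ only in their objects.
\<close>

lemma arrow_category:
  assumes \<O>: "\<O> \<subseteq> Collect bimod" and
    "Obj N = \<O>" "Arr N = arrows \<O>" "Dom N = Src" "Cod N = Tgt" "Ident N = bimod_ident M" "Comp N = bimod_comp M"
  shows "category N"
proof
  note [simp] = assms(2-)
  note [simp] = ident_arrow[OF _ \<O>] comp_arrow[OF _ _ _ \<O>]
  have m: "Map f \<in> Arr M" "Dom M (Map f) = Und (Src f)" "Cod M (Map f) = Und (Tgt f)"
     "Src f \<in> \<O>" "Tgt f \<in> \<O>" if "f \<in> arrows \<O>" for f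
    using that by (simp_all add: bimod_arrows_def in_hom)
  have h: "f \<in> hom N X Y \<longleftrightarrow> f \<in> arrows \<O> \<and> Src f = X \<and> Tgt f = Y" for f X Y
    by (auto simp: hom_def)
  show "Dom N f \<in> Obj N" "Cod N f \<in> Obj N" if "f \<in> Arr N" for f
    using that m by simp_all
  show "Ident N X \<in> hom N X X" if "X \<in> Obj N" for X
    using that unfolding h by (simp, simp add: bimod_ident_def)
  show "Comp N g f \<in> hom N X Z" if "f \<in> hom N X Y" "g \<in> hom N Y Z" for f g X Y Z
    using that unfolding h by (simp, simp add: bimod_comp_def)
  show "Comp N f (Ident N X) = f" "Comp N (Ident N Y) f = f" if "f \<in> hom N X Y" for f X Y
    using that unfolding h by (auto intro!: bimod_arrow.equality simp: bimod_comp_def bimod_ident_def m)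
  show "Comp N (Comp N h g) f = Comp N h (Comp N g f)"
    if "f \<in> hom N W X" "g \<in> hom N X Y" "h \<in> hom N Y Z" for f g h W X Y Z
    using that unfolding h by (simp add: bimod_comp_def m)
qed

abbreviation "YD_objects \<equiv> {V. bimod V \<and> yd_condition M C B ev V}"
abbreviation "H_objects \<equiv> {V. bimod V \<and> h_condition M C B ev V}"
abbreviation "YD \<equiv> YD_category M C B ev"
abbreviation "H \<equiv> H_category M C B ev"
abbreviation tensor_of_arrows (infixr "\<oslash>\<^sub>A" 72) where "tensor_of_arrows \<equiv> bimod_tensor_arrow M C B"

lemma YD_simps [simp]:
  "Obj YD = YD_objects" "Arr YD = arrows YD_objects" "Dom YD = Src" "Cod YD = Tgt"
  "Ident YD = bimod_ident M" "Comp YD = bimod_comp M" "Unit YD = \<one>" "TensorO YD = tensor"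
  "TensorA YD = tensor_of_arrows"
  by (simp_all add: YD_category_def)

lemma H_simps [simp]:
  "Obj H = H_objects" "Arr H = arrows H_objects" "Dom H = Src" "Cod H = Tgt"
  "Ident H = bimod_ident M" "Comp H = bimod_comp M"
  by (simp_all add: H_category_def)

lemma hom_YD: "\<phi> \<in> hom YD V W \<longleftrightarrow> \<phi> \<in> arrows YD_objects \<and> Src \<phi> = V \<and> Tgt \<phi> = W"
  by (auto simp: hom_def)

lemma hom_H: "\<phi> \<in> hom H V W \<longleftrightarrow> \<phi> \<in> arrows H_objects \<and> Src \<phi> = V \<and> Tgt \<phi> = W"
  by (auto simp: hom_def)

lemma arrows_typing:
  assumes "\<phi> \<in> arrows \<O>"
  shows "Map \<phi> \<in> Arr M" "Dom M (Map \<phi>) = Und (Src \<phi>)" "Cod M (Map \<phi>) = Und (Tgt \<phi>)"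
    "Src \<phi> \<in> \<O>" "Tgt \<phi> \<in> \<O>"
  using assms by (simp_all add: bimod_arrows_def in_hom)

lemma tensor_ident:
  assumes "bimod V" "bimod W"
  shows "bimod_ident M V \<oslash>\<^sub>A bimod_ident M W = bimod_ident M (V \<oslash> W)"
  using assms by (simp add: bimod_tensor_arrow_def bimod_ident_def)

lemma tensor_comp:
  assumes "\<phi> \<in> arrows \<O>" "\<phi>' \<in> arrows \<O>" "Tgt \<phi> = Src \<phi>'" "\<psi> \<in> arrows \<P>" "\<psi>' \<in> arrows \<P>" "Tgt \<psi> = Src \<psi>'"
  shows "bimod_comp M \<phi>' \<phi> \<oslash>\<^sub>A bimod_comp M \<psi>' \<psi> = bimod_comp M (\<phi>' \<oslash>\<^sub>A \<psi>') (\<phi> \<oslash>\<^sub>A \<psi>)"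
  using assms by (simp add: bimod_tensor_arrow_def bimod_comp_def interchange arrows_typing)

lemma tensor_arrow_assoc:
  assumes "\<phi> \<in> arrows \<O>" "\<psi> \<in> arrows \<P>" "\<chi> \<in> arrows \<Q>"
    "\<O> \<subseteq> Collect bimod" "\<P> \<subseteq> Collect bimod" "\<Q> \<subseteq> Collect bimod"
  shows "(\<phi> \<oslash>\<^sub>A \<psi>) \<oslash>\<^sub>A \<chi> = \<phi> \<oslash>\<^sub>A \<psi> \<oslash>\<^sub>A \<chi>"
proof -
  note [simp] = assms(1-3)[THEN arrows_typing(1)]
  have "bimod (Src \<phi>)" "bimod (Tgt \<phi>)" "bimod (Src \<psi>)" "bimod (Tgt \<psi>)" "bimod (Src \<chi>)" "bimod (Tgt \<chi>)"
    using assms by (auto dest: arrows_typing(4,5))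
  then show ?thesis by (simp add: bimod_tensor_arrow_def tensor_assoc)
qed

lemma tensor_arrow_unit:
  assumes "\<phi> \<in> arrows \<O>" "\<O> \<subseteq> Collect bimod"
  shows "bimod_ident M \<one> \<oslash>\<^sub>A \<phi> = \<phi>" "\<phi> \<oslash>\<^sub>A bimod_ident M \<one> = \<phi>"
proof -
  note [simp] = assms(1)[THEN arrows_typing(1)]
  have "bimod (Src \<phi>)" "bimod (Tgt \<phi>)" using assms by (auto dest: arrows_typing(4,5))
  then show "bimod_ident M \<one> \<oslash>\<^sub>A \<phi> = \<phi>" "\<phi> \<oslash>\<^sub>A bimod_ident M \<one> = \<phi>"
    by (auto intro!: bimod_arrow.equality simp: bimod_tensor_arrow_def bimod_ident_def tensor_unit)
qed

lemma YD_monoidal: "strict_monoidal_category YD"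
proof (rule strict_monoidal_category.intro)
  show "category YD"
    by (rule arrow_category[of YD_objects]) auto
  have bm: "YD_objects \<subseteq> Collect bimod" by auto
  have clo: "V \<oslash> W \<in> YD_objects" if "V \<in> YD_objects" "W \<in> YD_objects" for V W
    using that by (auto intro: bimod_tensor_bimod yd_tensor)
  show "strict_monoidal_category_axioms YD"
  proof
    show "Unit YD \<in> Obj YD"
      by (simp add: bimod_unit yd_unit)
    show "V \<odot>\<^bsub>YD\<^esub> W \<in> Obj YD" if "V \<in> Obj YD" "W \<in> Obj YD" for V W
      using that clo by simp
    show "\<phi> \<otimes>\<^bsub>YD\<^esub> \<psi> \<in> hom YD (V \<odot>\<^bsub>YD\<^esub> W) (V' \<odot>\<^bsub>YD\<^esub> W')"
      if "\<phi> \<in> hom YD V V'" "\<psi> \<in> hom YD W W'" for \<phi> \<psi> V V' W W'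
      using that tensor_arrow[OF _ _ bm bm clo, of \<phi> \<psi>] by (auto simp: hom_YD bimod_tensor_arrow_def)
    show "\<iota>\<^bsub>YD\<^esub> V \<otimes>\<^bsub>YD\<^esub> \<iota>\<^bsub>YD\<^esub> W = \<iota>\<^bsub>YD\<^esub> (V \<odot>\<^bsub>YD\<^esub> W)" if "V \<in> Obj YD" "W \<in> Obj YD" for V W
      using that by (simp add: tensor_ident)
    show "(\<phi>' \<cdot>\<^bsub>YD\<^esub> \<phi>) \<otimes>\<^bsub>YD\<^esub> (\<psi>' \<cdot>\<^bsub>YD\<^esub> \<psi>) = (\<phi>' \<otimes>\<^bsub>YD\<^esub> \<psi>') \<cdot>\<^bsub>YD\<^esub> (\<phi> \<otimes>\<^bsub>YD\<^esub> \<psi>)"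
      if "\<phi> \<in> hom YD V V'" "\<phi>' \<in> hom YD V' V''" "\<psi> \<in> hom YD W W'" "\<psi>' \<in> hom YD W' W''"
      for \<phi> \<phi>' \<psi> \<psi>' V V' V'' W W' W''
      using that by (simp add: hom_YD tensor_comp[of _ YD_objects _ _ YD_objects])
    show "(U \<odot>\<^bsub>YD\<^esub> V) \<odot>\<^bsub>YD\<^esub> W = U \<odot>\<^bsub>YD\<^esub> (V \<odot>\<^bsub>YD\<^esub> W)" if "U \<in> Obj YD" "V \<in> Obj YD" "W \<in> Obj YD" for U V W
      using that by (simp add: tensor_assoc)
    show "Unit YD \<odot>\<^bsub>YD\<^esub> V = V" "V \<odot>\<^bsub>YD\<^esub> Unit YD = V" if "V \<in> Obj YD" for V
      using that by (simp_all add: tensor_unit)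
    show "(\<phi> \<otimes>\<^bsub>YD\<^esub> \<psi>) \<otimes>\<^bsub>YD\<^esub> \<chi> = \<phi> \<otimes>\<^bsub>YD\<^esub> (\<psi> \<otimes>\<^bsub>YD\<^esub> \<chi>)"
      if "\<phi> \<in> Arr YD" "\<psi> \<in> Arr YD" "\<chi> \<in> Arr YD" for \<phi> \<psi> \<chi>
      using that by (simp add: tensor_arrow_assoc[OF _ _ _ bm bm bm])
    show "\<iota>\<^bsub>YD\<^esub> (Unit YD) \<otimes>\<^bsub>YD\<^esub> \<phi> = \<phi>" "\<phi> \<otimes>\<^bsub>YD\<^esub> \<iota>\<^bsub>YD\<^esub> (Unit YD) = \<phi>" if "\<phi> \<in> Arr YD" for \<phi>
      using that by (simp_all add: tensor_arrow_unit[OF _ bm])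
  qed
qed

lemma YD_acts_on_H:
  "left_module_category YD H tensor tensor_of_arrows
    (\<lambda>U V W. bimod_ident M (U \<oslash> V \<oslash> W)) (bimod_ident M)"
proof (rule left_module_category.intro[OF YD_monoidal])
  have yd: "YD_objects \<subseteq> Collect bimod" and h: "H_objects \<subseteq> Collect bimod" by auto
  show cat: "category H"
    by (rule arrow_category[OF h]) auto
  interpret N: category H by (rule cat)
  note Comp_Ident_H = N.Comp_Ident[unfolded H_simps] and Ident_Comp_H = N.Ident_Comp[unfolded H_simps]
  have clo: "V \<oslash> W \<in> H_objects" if "V \<in> YD_objects" "W \<in> H_objects" for V W
    using that by (auto intro: bimod_tensor_bimod h_tensor)
  have act: "\<phi> \<oslash>\<^sub>A \<psi> \<in> hom H (V \<oslash> W) (V' \<oslash> W')"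
    if "\<phi> \<in> hom YD V V'" "\<psi> \<in> hom H W W'" for \<phi> \<psi> V V' W W'
    using that tensor_arrow[OF _ _ yd h clo, of \<phi> \<psi>] by (auto simp: hom_YD hom_H bimod_tensor_arrow_def)
  have id: "bimod_ident M W \<in> hom H W W" if "W \<in> H_objects" for W
    using that N.Ident_hom by simp
  have ass: "(U \<oslash> V) \<oslash> W = U \<oslash> V \<oslash> W" if "U \<in> YD_objects" "V \<in> YD_objects" "W \<in> H_objects" for U V W
    using that by (simp add: tensor_assoc)
  have un: "\<one> \<oslash> W = W" if "W \<in> H_objects" for W
    using that by (simp add: tensor_unit)
  show "left_module_category_axioms YD H tensor tensor_of_arrows
    (\<lambda>U V W. bimod_ident M (U \<oslash> V \<oslash> W)) (bimod_ident M)"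
  proof
    show "V \<oslash> W \<in> Obj H" if "V \<in> Obj YD" "W \<in> Obj H" for V W
      using that clo by simp
    show "\<phi> \<oslash>\<^sub>A \<psi> \<in> hom H (V \<oslash> W) (V' \<oslash> W')" if "\<phi> \<in> hom YD V V'" "\<psi> \<in> hom H W W'" for \<phi> \<psi> V V' W W'
      using that by (rule act)
    show "Ident YD V \<oslash>\<^sub>A Ident H W = Ident H (V \<oslash> W)" if "V \<in> Obj YD" "W \<in> Obj H" for V W
      using that by (simp add: tensor_ident)
    show "(\<phi>' \<cdot>\<^bsub>YD\<^esub> \<phi>) \<oslash>\<^sub>A (\<psi>' \<cdot>\<^bsub>H\<^esub> \<psi>) = (\<phi>' \<oslash>\<^sub>A \<psi>') \<cdot>\<^bsub>H\<^esub> (\<phi> \<oslash>\<^sub>A \<psi>)"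
      if "\<phi> \<in> hom YD V V'" "\<phi>' \<in> hom YD V' V''" "\<psi> \<in> hom H W W'" "\<psi>' \<in> hom H W' W''"
      for \<phi> \<phi>' \<psi> \<psi>' V V' V'' W W' W''
      using that by (simp add: hom_YD hom_H tensor_comp[of _ YD_objects _ _ H_objects])
    show "bimod_ident M (U \<oslash> V \<oslash> W) \<in> hom H ((U \<odot>\<^bsub>YD\<^esub> V) \<oslash> W) (U \<oslash> V \<oslash> W)"
      if "U \<in> Obj YD" "V \<in> Obj YD" "W \<in> Obj H" for U V W
      using that id clo ass by simp
    show "iso H (bimod_ident M (U \<oslash> V \<oslash> W))" if "U \<in> Obj YD" "V \<in> Obj YD" "W \<in> Obj H" for U V W
      using that N.iso_Ident clo by simp
    show "bimod_ident M (U' \<oslash> V' \<oslash> W') \<cdot>\<^bsub>H\<^esub> ((\<phi> \<otimes>\<^bsub>YD\<^esub> \<psi>) \<oslash>\<^sub>A \<chi>)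
        = (\<phi> \<oslash>\<^sub>A \<psi> \<oslash>\<^sub>A \<chi>) \<cdot>\<^bsub>H\<^esub> bimod_ident M (U \<oslash> V \<oslash> W)"
      if t: "\<phi> \<in> hom YD U U'" "\<psi> \<in> hom YD V V'" "\<chi> \<in> hom H W W'" for \<phi> \<psi> \<chi> U U' V V' W W'
    proof -
      have "(\<phi> \<otimes>\<^bsub>YD\<^esub> \<psi>) \<oslash>\<^sub>A \<chi> = \<phi> \<oslash>\<^sub>A \<psi> \<oslash>\<^sub>A \<chi>"
        using t tensor_arrow_assoc[OF _ _ _ yd yd h] by (simp add: hom_YD hom_H)
      moreover have "\<phi> \<oslash>\<^sub>A \<psi> \<oslash>\<^sub>A \<chi> \<in> hom H (U \<oslash> V \<oslash> W) (U' \<oslash> V' \<oslash> W')"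
        using t by (intro act)
      ultimately show ?thesis
        using Comp_Ident_H Ident_Comp_H by simp
    qed
    show "bimod_ident M W \<in> hom H (Unit YD \<oslash> W) W" if "W \<in> Obj H" for W
      using that id un by simp
    show "iso H (bimod_ident M W)" if "W \<in> Obj H" for W
      using that N.iso_Ident by simp
    show "bimod_ident M W' \<cdot>\<^bsub>H\<^esub> (Ident YD (Unit YD) \<oslash>\<^sub>A \<chi>) = \<chi> \<cdot>\<^bsub>H\<^esub> bimod_ident M W"
      if t: "\<chi> \<in> hom H W W'" for \<chi> W W'
      using Comp_Ident_H[OF t] Ident_Comp_H[OF t] t tensor_arrow_unit(1)[OF _ h] by (simp add: hom_H)
    show "(Ident YD T \<oslash>\<^sub>A bimod_ident M (U \<oslash> V \<oslash> W)) \<cdot>\<^bsub>H\<^esub> bimod_ident M (T \<oslash> (U \<odot>\<^bsub>YD\<^esub> V) \<oslash> W)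
        = bimod_ident M (T \<oslash> U \<oslash> V \<oslash> W) \<cdot>\<^bsub>H\<^esub> bimod_ident M ((T \<odot>\<^bsub>YD\<^esub> U) \<oslash> V \<oslash> W)"
      if t: "T \<in> Obj YD" "U \<in> Obj YD" "V \<in> Obj YD" "W \<in> Obj H" for T U V W
      using t ass[of U V W] ass[of T U "V \<oslash> W"] clo[of V W] clo[of U "V \<oslash> W"] tensor_ident[of T "U \<oslash> V \<oslash> W"]
      by simp
    show "(Ident YD V \<oslash>\<^sub>A bimod_ident M W) \<cdot>\<^bsub>H\<^esub> bimod_ident M (V \<oslash> Unit YD \<oslash> W) = Ident YD V \<oslash>\<^sub>A Ident H W"
      if t: "V \<in> Obj YD" "W \<in> Obj H" for V W
      using t un Comp_Ident_H[OF id[OF clo], of V W] tensor_ident[of V W] by simp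
  qed
qed

end

theorem proposition3p2p1:
  fixes M :: "('o, 'a, 'm) braided_category_scheme"
    and C B :: "('o, 'a) hopf"
    and ev :: "'a"
  assumes "dually_paired_hopf_algebras M C B ev"
  shows "left_module_category (YD_category M C B ev) (H_category M C B ev)
    (bimod_tensor M C B) (bimod_tensor_arrow M C B)
    (\<lambda>U V W. bimod_ident M (bimod_tensor M C B U (bimod_tensor M C B V W)))
    (\<lambda>W. bimod_ident M W)"
proof -
  interpret dually_paired_hopf_algebras M C B ev by fact
  interpret dual_pairing M C B ev by unfold_locales
  show ?thesis by (rule YD_acts_on_H)
qed

end
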